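(* Let $\lambda$ and $\mu$ be partitions of lengths $r_1$ and $r_2$, let $r=r_1+r_2$, and let $\alpha\in\mathbb{R}$ with $\alpha+r>-1$. For a positive integer $k$ and $n\in\mathbb{N}_{\lambda,\mu}$ large enough, let $x^{(\alpha)}_{k,n}$ denote the $k$th positive real zero (in increasing order) of the exceptional Laguerre polynomial $L^{(\alpha)}_{\lambda,\mu,n}$. If $\Omega^{(\alpha)}_{\lambda,\mu}(0)\neq 0$, then for every positive integer $k$ $$\lim_{n\to\infty}\sqrt{4n\,x^{(\alpha)}_{k,n}}=j_{\alpha+r,k},$$ where $n$ tends to infinity through $\mathbb{N}_{\lambda,\mu}$ and $j_{\alpha+r,k}$ is the $k$th positive zero of the Bessel function of the first kind $J_{\alpha+r}$.
   Context: For $\alpha\in\mathbb{R}$ and an integer $n\ge 0$, $L^{(\alpha)}_n(x)=\frac{e^x x^{-\alpha}}{n!}\frac{d^n}{dx^n}\left(e^{-x}x^{n+\alpha}\right)$ is the Laguerre polynomial of degree $n$ (so $L_n^{(\alpha)}(x)=\sum_{k=0}^n\binom{n+\alpha}{n-k}\frac{(-x)^k}{k!}$). For sufficiently differentiable functions, $\mathrm{Wr}[f_1,\dots,f_r]=\det\left(\frac{d^{j-1}}{dx^{j-1}}f_i\right)_{1\le i,j\le r}$ is the Wronskian (the empty Wronskian is $1$). A partition $\lambda=(\lambda_1,\dots,\lambda_{r_1})$ is a weakly decreasing (possibly empty) finite sequence of positive integers, $r_1$ is its length and $|\lambda|=\sum_j\lambda_j$. To partitions $\lambda$ of length $r_1$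 and $\mu$ of length $r_2$ associate $n_j=\lambda_j+r_1-j$ ($1\le j\le r_1$), $m_j=\mu_j+r_2-j$ ($1\le j\le r_2$), $r=r_1+r_2$, and the functions $f_j(x)=L^{(\alpha)}_{n_j}(x)$ for $j=1,\dots,r_1$ and $f_{r_1+j}(x)=e^xL^{(\alpha)}_{m_j}(-x)$ for $j=1,\dots,r_2$. The generalized Laguerre polynomial is $\Omega^{(\alpha)}_{\lambda,\mu}(x)=e^{-r_2x}\,\mathrm{Wr}[f_1,\dots,f_r](x)$; it is a polynomial. The degree sequence is $$\mathbb{N}_{\lambda,\mu}=\{n\in\{0,1,2,\dots\} : n\ge|\lambda|+|\mu|-r_1 \text{ and } n-|\lambda|-|\mu|\ne\lambda_j-j \text{ for } j=1,\dots,r_1\}.$$ For $n\in\mathbb{N}_{\lambda,\mu}$ the exceptional Laguerre polynomial is $$L^{(\alpha)}_{\lambda,\mu,n}(x)=e^{-r_2x}\,\mathrm{Wr}\left[f_1,\dots,f_r,L^{(\alpha)}_s\right](x),\qquad s=n-|\lambda|-|\mu|+r_1,$$ which is a polynomial of degree $n$. When $\alpha+r>-1$, the number of positive real zeros of $L^{(\alpha)}_{\lambda,\mu,n}$ tends to infinity as $n\to\infty$, so that $x^{(\alpha)}_{k,n}$ is defined for all large $n$. *)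

theory Defs
  imports "HOL-Analysis.Analysis" "Jordan_Normal_Form.Determinant"
begin

definition laguerre :: "real \<Rightarrow> nat \<Rightarrow> real poly" where
  "laguerre \<alpha> n =
     (\<Sum>k\<le>n. monom (((real n + \<alpha>) gchoose (n - k)) * (-1) ^ k / fact k) k)"

lemma poly_laguerre:
  "poly (laguerre \<alpha> n) x = (\<Sum>k\<le>n. ((real n + \<alpha>) gchoose (n - k)) * (- x) ^ k / fact k)"
  by (simp add: laguerre_def poly_sum poly_monom power_minus[of x] mult.assoc)

lemma sum_pascal:
  fixes g :: "nat \<Rightarrow> real"
  shows "(\<Sum>k\<le>Suc m. real (Suc m choose k) * g k)
       = (\<Sum>k\<le>m. real (m choose k) * (g (Suc k) + g k))"
proof -
  have "(\<Sum>k\<le>Suc m. real (Suc m choose k) * g k)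
      = g 0 + (\<Sum>k\<le>m. real (Suc m choose Suc k) * g (Suc k))"
    by (simp only: sum.atMost_Suc_shift) simp
  also have "\<dots> = (\<Sum>k\<le>m. real (m choose k) * g (Suc k))
      + (g 0 + (\<Sum>k\<le>m. real (m choose Suc k) * g (Suc k)))"
    by (simp add: algebra_simps sum.distrib)
  also have "g 0 + (\<Sum>k\<le>m. real (m choose Suc k) * g (Suc k))
      = (\<Sum>k\<le>Suc m. real (m choose k) * g k)"
    by (simp only: sum.atMost_Suc_shift) simp
  also have "\<dots> = (\<Sum>k\<le>m. real (m choose k) * g k)"
    by simp
  finally show ?thesis
    by (simp add: algebra_simps sum.distrib)
qed

lemma higher_deriv_exp_powr:
  fixes b :: real
  assumes "x > 0"
  shows "(deriv ^^ m) (\<lambda>x. exp (- x) * x powr b) x =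
    (\<Sum>k\<le>m. real (m choose k) * ((-1) ^ k * (fact (m - k) * (b gchoose (m - k)))
       * (exp (- x) * x powr (b - real (m - k)))))"
  using assms
proof (induction m arbitrary: x)
  case 0
  then show ?case by simp
next
  case (Suc m)
  let ?ff = "\<lambda>i. fact i * (b gchoose i) :: real"
  let ?S = "\<lambda>x. \<Sum>k\<le>m. real (m choose k) * ((-1) ^ k * ?ff (m - k)
       * (exp (- x) * x powr (b - real (m - k))))"
  let ?T = "\<lambda>k. (-1) ^ k * ?ff (Suc m - k) * (exp (- x) * x powr (b - real (Suc m - k)))"
  have ff: "?ff (Suc i) = ?ff i * (b - real i)" for i
    by (simp only: gbinomial_mult_fact prod.atLeast0_lessThan_Suc)
  have step: "(-1) ^ k * ?ff (m - k) * (- exp (- x) * x powr (b - real (m - k))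
        + exp (- x) * ((b - real (m - k)) * x powr (b - real (m - k) - 1)))
      = ?T (Suc k) + ?T k" if "k \<le> m" for k
  proof -
    have "Suc m - k = Suc (m - k)" using that by simp
    then show ?thesis
      by (simp only: ff diff_Suc_Suc power_Suc) (simp add: algebra_simps)
  qed
  have "(?S has_real_derivative (\<Sum>k\<le>m. real (m choose k) * ((-1) ^ k * ?ff (m - k)
       * (- exp (- x) * x powr (b - real (m - k))
        + exp (- x) * ((b - real (m - k)) * x powr (b - real (m - k) - 1)))))) (at x)"
    using Suc.prems by (auto intro!: derivative_eq_intros simp: algebra_simps)
  also have "(\<Sum>k\<le>m. real (m choose k) * ((-1) ^ k * ?ff (m - k)
       * (- exp (- x) * x powr (b - real (m - k))
        + exp (- x) * ((b - real (m - k)) * x powr (b - real (m - k) - 1)))))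
      = (\<Sum>k\<le>m. real (m choose k) * (?T (Suc k) + ?T k))"
    by (rule sum.cong[OF refl]) (use step in simp)
  also have "\<dots> = (\<Sum>k\<le>Suc m. real (Suc m choose k) * ?T k)"
    by (rule sum_pascal[symmetric])
  finally have "(?S has_real_derivative (\<Sum>k\<le>Suc m. real (Suc m choose k) * ?T k)) (at x)" .
  then have "((deriv ^^ m) (\<lambda>x. exp (- x) * x powr b) has_real_derivative
      (\<Sum>k\<le>Suc m. real (Suc m choose k) * ?T k)) (at x)"
    by (rule has_field_derivative_transform_within_open[where S = "{0<..}"])
       (use Suc in auto)
  then show ?case
    by (simp only: funpow.simps o_apply) (rule DERIV_imp_deriv)
qed

theorem laguerre_rodrigues:
  assumes "x > 0"
  shows "poly (laguerre \<alpha> n) x = exp x * x powr (- \<alpha>) / fact n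
           * (deriv ^^ n) (\<lambda>x. exp (- x) * x powr (real n + \<alpha>)) x"
proof -
  have "exp x * x powr (- \<alpha>) / fact n * (real (n choose k)
          * ((-1) ^ k * (fact (n - k) * ((real n + \<alpha>) gchoose (n - k)))
          * (exp (- x) * x powr (real n + \<alpha> - real (n - k)))))
      = ((real n + \<alpha>) gchoose (n - k)) * (- x) ^ k / fact k" if "k \<le> n" for k
  proof -
    have 1: "real (n choose k) * fact (n - k) / fact n = 1 / fact k"
      using that by (simp add: binomial_fact)
    have 2: "x powr (- \<alpha>) * x powr (real n + \<alpha> - real (n - k)) = x ^ k"
      using that assms by (simp add: of_nat_diff powr_realpow flip: powr_add)
    have 3: "exp x * exp (- x) = 1"
      by (simp flip: exp_add)
    have "exp x * x powr (- \<alpha>) / fact n * (real (n choose k)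
          * ((-1) ^ k * (fact (n - k) * ((real n + \<alpha>) gchoose (n - k)))
          * (exp (- x) * x powr (real n + \<alpha> - real (n - k)))))
      = (exp x * exp (- x)) * (x powr (- \<alpha>) * x powr (real n + \<alpha> - real (n - k)))
        * (real (n choose k) * fact (n - k) / fact n)
        * ((-1) ^ k * ((real n + \<alpha>) gchoose (n - k)))"
      by simp
    also have "\<dots> = ((real n + \<alpha>) gchoose (n - k)) * (- x) ^ k / fact k"
      unfolding 1 2 3 by (simp add: power_minus[of x])
    finally show ?thesis .
  qed
  then show ?thesis
    by (simp only: poly_laguerre higher_deriv_exp_powr[OF assms] sum_distrib_left)
       (auto intro!: sum.cong)
qed

definition Wr :: "(real \<Rightarrow> real) list \<Rightarrow> real \<Rightarrow> real" where
  "Wr fs x = Determinant.det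
     (Matrix.mat (length fs) (length fs) (\<lambda>(i, j). (deriv ^^ j) (fs ! i) x))"

definition is_partition :: "nat list \<Rightarrow> bool" where
  "is_partition lam \<longleftrightarrow> sorted_wrt (\<ge>) lam \<and> (\<forall>p \<in> set lam. p > 0)"

text \<open>
  Lists are indexed from \<open>0\<close>: entry \<open>i\<close> of the list below is
  \<open>n\<^sub>j = \<lambda>\<^sub>j + r\<^sub>1 - j\<close> with \<open>j = i + 1\<close>.
\<close>

definition shifted_parts :: "nat list \<Rightarrow> nat list" where
  "shifted_parts lam = map (\<lambda>i. lam ! i + length lam - (i + 1)) [0..<length lam]"

definition seed_functions :: "real \<Rightarrow> nat list \<Rightarrow> nat list \<Rightarrow> (real \<Rightarrow> real) list" where
  "seed_functions \<alpha> lam mu =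
     map (\<lambda>n x. poly (laguerre \<alpha> n) x) (shifted_parts lam)
   @ map (\<lambda>m x. exp x * poly (laguerre \<alpha> m) (- x)) (shifted_parts mu)"

definition generalized_laguerre :: "real \<Rightarrow> nat list \<Rightarrow> nat list \<Rightarrow> real \<Rightarrow> real" where
  "generalized_laguerre \<alpha> lam mu x =
     exp (- real (length mu) * x) * Wr (seed_functions \<alpha> lam mu) x"

definition degree_sequence :: "nat list \<Rightarrow> nat list \<Rightarrow> nat set" where
  "degree_sequence lam mu =
     {n. int n \<ge> int (sum_list lam) + int (sum_list mu) - int (length lam) \<and>
         (\<forall>j \<in> {1..length lam}.
            int n - int (sum_list lam) - int (sum_list mu) \<noteq> int (lam ! (j - 1)) - int j)}"

text \<open>
  For \<open>n\<close> in the degree sequence the subtraction on natural numbers in the index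
  \<open>s = n - |\<lambda>| - |\<mu>| + r\<^sub>1\<close> does not truncate.
\<close>

definition exceptional_laguerre ::
    "real \<Rightarrow> nat list \<Rightarrow> nat list \<Rightarrow> nat \<Rightarrow> real \<Rightarrow> real" where
  "exceptional_laguerre \<alpha> lam mu n x =
     exp (- real (length mu) * x) *
     Wr (seed_functions \<alpha> lam mu @
         [poly (laguerre \<alpha> (n + length lam - (sum_list lam + sum_list mu)))]) x"

text \<open>
  The series represents \<open>J\<^sub>\<nu>\<close> for positive arguments, the only ones used here.
\<close>

definition bessel_J :: "real \<Rightarrow> real \<Rightarrow> real" where
  "bessel_J \<nu> x =
     (\<Sum>m. (-1) ^ m / (fact m * Gamma (real m + \<nu> + 1)) * (x / 2) powr (2 * real m + \<nu>))"

lemma summable_bessel_J: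
  assumes "x > 0"
  shows "summable (\<lambda>m. (-1) ^ m / (fact m * Gamma (real m + \<nu> + 1))
           * (x / 2) powr (2 * real m + \<nu>))"
    (is "summable ?t")
proof -
  define N where "N = nat \<lceil>\<bar>\<nu>\<bar> + (x / 2)\<^sup>2 + 2\<rceil>"
  have "norm (?t (Suc m)) \<le> 1 / 2 * norm (?t m)" if "m \<ge> N" for m
  proof -
    have m: "real m \<ge> \<bar>\<nu>\<bar> + (x / 2)\<^sup>2 + 2"
      using that unfolding N_def by linarith
    define c where "c = real m + \<nu> + 1"
    have x2: "(x / 2)\<^sup>2 \<ge> 0" by simp
    have c: "c \<ge> (x / 2)\<^sup>2" "c > 0"
      using m x2 unfolding c_def by linarith+
    have m1: "real m + 1 \<ge> 2" using m x2 by linarith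
    have G: "Gamma (real (Suc m) + \<nu> + 1) = c * Gamma c"
    proof -
      have "c \<notin> \<int>\<^sub>\<le>\<^sub>0" using c(2) nonpos_Ints_nonpos[of c] by auto
      moreover have "real (Suc m) + \<nu> + 1 = c + 1" by (simp add: c_def)
      ultimately show ?thesis by (simp only: Gamma_plus1 not_False_eq_True)
    qed
    have P: "(x / 2) powr (2 * real (Suc m) + \<nu>) = (x / 2)\<^sup>2 * (x / 2) powr (2 * real m + \<nu>)"
    proof -
      have "2 * real (Suc m) + \<nu> = 2 + (2 * real m + \<nu>)" by simp
      moreover have "(x / 2) powr 2 = (x / 2)\<^sup>2"
        using assms powr_realpow[of "x / 2" 2] by simp
      ultimately show ?thesis by (simp only: powr_add)
    qed
    have F: "fact (Suc m) = (real m + 1) * fact m" by simp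
    have n: "norm ((- 1) ^ i / (a * b) * p) = p / (a * b)"
      if "a > 0" "b > 0" "p \<ge> 0" for i and a b p :: real
      using that by (simp add: abs_mult power_abs)
    have c': "real m + \<nu> + 1 = c" by (simp add: c_def)
    have Gc: "Gamma c > 0" using c(2) by (rule Gamma_real_pos)
    have "norm (?t (Suc m)) = (x / 2)\<^sup>2 / ((real m + 1) * c) * norm (?t m)"
    proof -
      have "norm (?t (Suc m)) = ((x / 2)\<^sup>2 * (x / 2) powr (2 * real m + \<nu>))
              / (((real m + 1) * fact m) * (c * Gamma c))"
        unfolding G P F by (rule n) (use m1 c Gc in auto)
      moreover have "norm (?t m) = (x / 2) powr (2 * real m + \<nu>) / (fact m * Gamma c)"
        unfolding c' by (rule n) (use Gc in auto)
      ultimately show ?thesis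
        by (simp only: times_divide_times_eq ac_simps)
    qed
    also have "\<dots> \<le> 1 / 2 * norm (?t m)"
    proof (rule mult_right_mono)
      have "2 * (x / 2)\<^sup>2 \<le> (real m + 1) * c"
        using m1 c x2 by (intro mult_mono) auto
      then show "(x / 2)\<^sup>2 / ((real m + 1) * c) \<le> 1 / 2"
        using c m1 by (simp add: divide_le_eq)
    qed (rule norm_ge_zero)
    finally show ?thesis .
  qed
  then show ?thesis
    by (intro summable_ratio_test[of "1 / 2" N]) auto
qed

text \<open>
  Zeros are counted without multiplicity. If \<open>f\<close> has no \<open>k\<close>th positive zero,
  \<open>pos_zero f k\<close> is unspecified.
\<close>

definition is_pos_zero :: "(real \<Rightarrow> real) \<Rightarrow> nat \<Rightarrow> real \<Rightarrow> bool" where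
  "is_pos_zero f k x \<longleftrightarrow> x > 0 \<and> f x = 0 \<and>
     finite {y. 0 < y \<and> y \<le> x \<and> f y = 0} \<and> card {y. 0 < y \<and> y \<le> x \<and> f y = 0} = k"

definition pos_zero :: "(real \<Rightarrow> real) \<Rightarrow> nat \<Rightarrow> real" where
  "pos_zero f k = (THE x. is_pos_zero f k x)"

lemma is_pos_zero_unique:
  assumes "is_pos_zero f k x" "is_pos_zero f k y"
  shows "x = y"
proof -
  have less: "\<not> a < b" if a: "is_pos_zero f k a" and b: "is_pos_zero f k b" for a b
  proof
    assume "a < b"
    let ?Z = "\<lambda>u. {z. 0 < z \<and> z \<le> u \<and> f z = 0}"
    have "?Z a \<subseteq> ?Z b"
      using \<open>a < b\<close> by fastforce
    moreover have "finite (?Z b)" "card (?Z a) = card (?Z b)"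
      using a b unfolding is_pos_zero_def by simp_all
    ultimately have "?Z a = ?Z b"
      using card_subset_eq[of "?Z b" "?Z a"] by blast
    moreover have "b \<in> ?Z b"
      using b unfolding is_pos_zero_def by simp
    ultimately have "b \<in> ?Z a"
      by simp
    then show False
      using \<open>a < b\<close> by simp
  qed
  show ?thesis
    using less[OF assms] less[OF assms(2,1)] by simp
qed

lemma pos_zero_eqI: "is_pos_zero f k x \<Longrightarrow> pos_zero f k = x"
  unfolding pos_zero_def by (blast intro: the_equality is_pos_zero_unique)

end

theory Submission
  imports Defs
begin

text \<open>
  Expanding the Wronskian along the row of \<open>L\<^sub>s\<close> gives \<open>\<Sum>\<^sub>j A\<^sub>j(x) L\<^sub>s\<^bsup>(j)\<^esup>(x)\<close> with cofactors
  \<open>A\<^sub>j\<close> independent of \<open>s\<close>, and \<open>A\<^sub>r = \<Omega>\<close>. On the scale \<open>x = z/s\<close> the \<open>j\<close>th derivative is of order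
  \<open>s\<^sup>j\<close>, so only \<open>j = r\<close> survives, and by a Mehler-Heine limit the rescaled polynomials converge
  to a multiple of \<open>\<Omega>(0) z\<^bsup>-\<nu>/2\<^esup> J\<^sub>\<nu>(2\<surd>z)\<close> with \<open>\<nu> = \<alpha> + r\<close>, uniformly on each \<open>[0, R]\<close> together
  with their derivatives. The positive zeros of this limit are simple and infinite in number, and
  it does not vanish at \<open>0\<close>; hence the \<open>k\<close>th positive zeros converge as well.
\<close>

subsection \<open>The Bessel-Clifford function\<close>

text \<open>The asymptotics rest on an exact identity: in the variable \<open>z = s x\<close> a
  Laguerre polynomial is a constant times the series of \<open>bessel_clifford \<alpha>\<close> with
  each coefficient multiplied by a number in \<open>[0, 1]\<close> that tends to 1. Dominated
  convergence therefore suffices, and since differentiation only raises the order, it covers all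
  derivatives and carries \<alpha> to \<open>\<alpha> + r\<close>. The \<open>k\<close>th zero is
  caught by counting zeros in \<open>(0, R]\<close>. A nonzero limit at \<open>0\<close> is
  essential for this: zeros gathering at that end would shift the index of every later one. There
  \<open>\<Omega>(0) \<noteq> 0\<close> and \<open>\<alpha> + r > -1\<close> enter. Since
  \<open>x = z / s\<close> and \<open>n / s\<close> tends to 1, \<open>4 n x\<close> tends to
  \<open>4 z\<close>, the square of the Bessel zero.\<close>

text \<open>The Bessel-Clifford function \<open>x\<^bsup>-\<nu>/2\<^esup> J\<^sub>\<nu>(2\<surd>x)\<close>. With the reciprocal Gamma function
  the series makes sense for every real \<open>\<nu>\<close>; this matters because only \<open>\<alpha> + r > -1\<close> is
  known, so \<open>\<alpha>\<close> itself may be a negative integer.\<close>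

definition clifford_coeff :: "real \<Rightarrow> nat \<Rightarrow> real" where
  "clifford_coeff \<nu> m = (-1) ^ m * rGamma (real m + \<nu> + 1) / fact m"

definition bessel_clifford :: "real \<Rightarrow> real \<Rightarrow> real" where
  "bessel_clifford \<nu> z = (\<Sum>m. clifford_coeff \<nu> m * z ^ m)"

lemma bessel_J_term:
  assumes "x > 0"
  shows "(-1) ^ m / (fact m * Gamma (real m + \<nu> + 1)) * (x / 2) powr (2 * real m + \<nu>) =
    (x / 2) powr \<nu> * (clifford_coeff \<nu> m * (x\<^sup>2 / 4) ^ m)"
proof -
  have "(x / 2) powr (2 * real m + \<nu>) = (x / 2) powr \<nu> * (x / 2) powr (real (2 * m))"
    by (simp add: powr_add)
  also have "(x / 2) powr (real (2 * m)) = (x / 2) ^ (2 * m)"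
    using assms by (subst powr_realpow) auto
  also have "\<dots> = (x\<^sup>2 / 4) ^ m"
    by (simp add: power_mult power_divide)
  \<comment> \<open>At a pole \<open>Gamma\<close> has the value 0, and division by 0 gives 0, which
    agrees with \<open>rGamma\<close>; so \<nu> needs no restriction.\<close>
  finally show ?thesis
    by (simp add: clifford_coeff_def rGamma_inverse_Gamma divide_simps)
qed

lemma summable_norm_clifford_coeff: "summable (\<lambda>m. norm (clifford_coeff \<nu> m * z ^ m))"
proof (rule powser_insidea)
  \<comment> \<open>Chosen so that \<open>x\<^sup>2 / 4\<close> exceeds
    \<open>\<bar>z\<bar>\<close>: convergence of the Bessel series at \<open>x\<close> gives
    absolute convergence of the power series at \<open>z\<close>.\<close>
  define x where "x = 2 * sqrt (\<bar>z\<bar> + 1)"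
  have x: "x > 0" "x\<^sup>2 / 4 = \<bar>z\<bar> + 1"
    by (simp_all add: x_def power_mult_distrib)
  have "summable (\<lambda>m. (x / 2) powr \<nu> * (clifford_coeff \<nu> m * (x\<^sup>2 / 4) ^ m))"
    using summable_bessel_J[OF x(1), of \<nu>] by (simp only: bessel_J_term[OF x(1)])
  then show "summable (\<lambda>m. clifford_coeff \<nu> m * (\<bar>z\<bar> + 1) ^ m)"
    using x by (subst (asm) summable_cmult_iff) auto
qed simp

lemma summable_clifford_coeff: "summable (\<lambda>m. clifford_coeff \<nu> m * z ^ m)"
  using summable_norm_clifford_coeff by (rule summable_norm_cancel)

lemma bessel_J_eq_clifford:
  assumes "x > 0"
  shows "bessel_J \<nu> x = (x / 2) powr \<nu> * bessel_clifford \<nu> (x\<^sup>2 / 4)"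
  unfolding bessel_J_def bessel_J_term[OF assms] bessel_clifford_def
  by (rule suminf_mult[OF summable_clifford_coeff])

lemma diffs_clifford_coeff: "diffs (clifford_coeff \<nu>) m = - clifford_coeff (\<nu> + 1) m"
proof -
  have "real (Suc m) + \<nu> + 1 = real m + (\<nu> + 1) + 1" by simp
  then show ?thesis
    unfolding diffs_def clifford_coeff_def fact_Suc by (simp only:) (simp add: field_simps del: of_nat_Suc)
qed

text \<open>The classical relation \<open>(x^-\<nu> J_\<nu>)' = - x^-\<nu> J_(\<nu>+1)\<close> in
  the variable \<open>z = x\<^sup>2 / 4\<close>.\<close>

lemma DERIV_bessel_clifford:
  "(bessel_clifford \<nu> has_real_derivative - bessel_clifford (\<nu> + 1) z) (at z)"
proof -
  have "((\<lambda>z. \<Sum>m. clifford_coeff \<nu> m * z ^ m) has_real_derivative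
      (\<Sum>m. diffs (clifford_coeff \<nu>) m * z ^ m)) (at z)"
    by (rule termdiffs_strong_converges_everywhere[OF summable_clifford_coeff])
  then show ?thesis
    using suminf_minus[OF summable_clifford_coeff[of "\<nu> + 1" z]]
    by (simp add: diffs_clifford_coeff bessel_clifford_def[abs_def])
qed

lemma continuous_on_bessel_clifford: "continuous_on S (bessel_clifford \<nu>)"
  by (rule continuous_at_imp_continuous_on) (blast intro: DERIV_isCont DERIV_bessel_clifford)

lemma bessel_clifford_0: "bessel_clifford \<nu> 0 = rGamma (\<nu> + 1)"
  unfolding bessel_clifford_def powser_zero by (simp add: clifford_coeff_def)

lemma bessel_clifford_0_neq_0:
  assumes "\<nu> > -1"
  shows "bessel_clifford \<nu> 0 \<noteq> 0"
proof -
  have "Gamma (\<nu> + 1) > 0" using assms by (intro Gamma_real_pos) simp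
  then show ?thesis by (simp add: bessel_clifford_0 rGamma_inverse_Gamma)
qed

text \<open>The functions of order \<open>\<nu> + 1\<close> (negated) and \<open>\<nu> + 2\<close>
  are the first two derivatives of \<open>F = bessel_clifford \<nu>\<close>, so this is the
  differential equation \<open>z F'' + (\<nu> + 1) F' + F = 0\<close>. Coefficientwise it is the
  functional equation of \<open>rGamma\<close>.\<close>

lemma bessel_clifford_recurrence:
  "z * bessel_clifford (\<nu> + 2) z - (\<nu> + 1) * bessel_clifford (\<nu> + 1) z + bessel_clifford \<nu> z = 0"
proof -
  let ?t = "\<lambda>\<nu> m. clifford_coeff \<nu> m * z ^ m"
  \<comment> \<open>The series of the first summand with its index shifted by one; the added term at
    index 0 is zero, so the sum does not change.\<close>
  define s where "s = (\<lambda>m. - real m * ?t (\<nu> + 1) m)"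
  have sh: "z * ?t (\<nu> + 2) m = s (Suc m)" for m
    by (simp add: s_def clifford_coeff_def add_ac field_simps del: of_nat_Suc)
       (simp add: algebra_simps)
  have "(\<lambda>m. z * ?t (\<nu> + 2) m) sums (z * bessel_clifford (\<nu> + 2) z)"
    unfolding bessel_clifford_def
    by (intro sums_mult summable_sums summable_clifford_coeff)
  then have "(\<lambda>m. s (Suc m)) sums (z * bessel_clifford (\<nu> + 2) z)"
    by (simp only: sh)
  then have "s sums (z * bessel_clifford (\<nu> + 2) z)"
    by (subst (asm) sums_Suc_iff) (simp add: s_def)
  then have "(\<lambda>m. s m - (\<nu> + 1) * ?t (\<nu> + 1) m + ?t \<nu> m) sums
     (z * bessel_clifford (\<nu> + 2) z - (\<nu> + 1) * bessel_clifford (\<nu> + 1) z + bessel_clifford \<nu> z)"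
    by (intro sums_add sums_diff sums_mult)
       (simp_all add: bessel_clifford_def summable_sums summable_clifford_coeff)
  moreover have "s m - (\<nu> + 1) * ?t (\<nu> + 1) m + ?t \<nu> m = 0" for m
  proof -
    have "rGamma (real m + \<nu> + 1) = (real m + \<nu> + 1) * rGamma (real m + (\<nu> + 1) + 1)"
      using rGamma_plus1[of "real m + \<nu> + 1"] by (simp add: add_ac)
    then show ?thesis
      unfolding s_def clifford_coeff_def by (simp only:) (simp add: field_simps)
  qed
  ultimately show ?thesis
    by (simp add: sums_iff)
qed

text \<open>At a double zero the energy \<open>E = F\<^sup>2 + F'\<^sup>2\<close> vanishes; Gronwall's inequality propagates
  this backwards along the differential equation to \<open>0\<close>, where \<open>F\<close> does not vanish.\<close>

lemma bessel_clifford_zero_simple: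
  assumes \<nu>: "\<nu> > -1" and z: "z > 0" "bessel_clifford \<nu> z = 0"
  shows "bessel_clifford (\<nu> + 1) z \<noteq> 0"
proof
  assume z': "bessel_clifford (\<nu> + 1) z = 0"
  let ?F = "bessel_clifford \<nu>" and ?G = "bessel_clifford (\<nu> + 1)"
  define E where "E x = (?F x)\<^sup>2 + (?G x)\<^sup>2" for x
  have F0: "?F a = 0" if a: "0 < a" "a < z" for a
  proof -
    \<comment> \<open>Solving the equation for \<open>F''\<close> divides by \<open>x\<close>, so a
      Gronwall constant exists only away from \<open>0\<close>: on \<open>[a, z]\<close> the factor
      \<open>1 / x\<close> is at most \<open>1 / a\<close>. The singular point itself is reached at
      the end by continuity.\<close>
    define C where "C = 1 + (1 + 2 * \<bar>\<nu> + 1\<bar>) / a"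
    define h where "h x = E x * exp (C * x)" for x
    define E' where "E' x = 2 * ?F x * (- ?G x) + 2 * ?G x * (- bessel_clifford (\<nu> + 2) x)" for x
    have dE: "(E has_real_derivative E' x) (at x)" for x
      unfolding E_def[abs_def] E'_def
      by (auto intro!: derivative_eq_intros DERIV_bessel_clifford[THEN DERIV_chain2]
            DERIV_bessel_clifford[of "\<nu> + 1", THEN DERIV_chain2] simp: add_ac)
    have "h a \<le> h z"
    proof (rule DERIV_nonneg_imp_nondecreasing[of a z h])
      fix x assume x: "a \<le> x" "x \<le> z"
      have x0: "x > 0" using a x by linarith
      have H: "bessel_clifford (\<nu> + 2) x = ((\<nu> + 1) * ?G x - ?F x) / x"
        using bessel_clifford_recurrence[of x \<nu>] x0 by (simp add: field_simps)
      have "- E' x \<le> C * E x"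
      proof -
        have fg: "2 * \<bar>?F x * ?G x\<bar> \<le> E x"
          unfolding E_def using sum_squares_bound[of "\<bar>?F x\<bar>" "\<bar>?G x\<bar>"] by (simp add: abs_mult)
        have G: "(?G x)\<^sup>2 \<le> E x" by (simp add: E_def)
        have E0: "E x \<ge> 0" by (simp add: E_def)
        have "- E' x = 2 * (?F x * ?G x) + (2 * (\<nu> + 1) * (?G x)\<^sup>2 - 2 * (?F x * ?G x)) / x"
          unfolding E'_def H by (simp add: power2_eq_square field_simps)
        also have "\<dots> \<le> E x + ((1 + 2 * \<bar>\<nu> + 1\<bar>) * E x) / x"
        proof (intro add_mono divide_right_mono)
          show "2 * (?F x * ?G x) \<le> E x" using fg by linarith
          have "2 * (\<nu> + 1) * (?G x)\<^sup>2 \<le> 2 * \<bar>\<nu> + 1\<bar> * E x"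
            using G \<nu> by (intro mult_mono) auto
          then show "2 * (\<nu> + 1) * (?G x)\<^sup>2 - 2 * (?F x * ?G x) \<le> (1 + 2 * \<bar>\<nu> + 1\<bar>) * E x"
            using fg by (simp add: algebra_simps)
        qed (use x0 in auto)
        also have "\<dots> \<le> E x + ((1 + 2 * \<bar>\<nu> + 1\<bar>) * E x) / a"
          using x a x0 E0 by (intro add_left_mono divide_left_mono) auto
        also have "\<dots> = C * E x"
          by (simp add: C_def field_simps)
        finally show ?thesis .
      qed
      then have "0 \<le> (E' x + C * E x) * exp (C * x)"
        by simp
      moreover have "(h has_real_derivative (E' x + C * E x) * exp (C * x)) (at x)"
        unfolding h_def[abs_def]
        by (auto intro!: derivative_eq_intros dE simp: algebra_simps)
      ultimately show "\<exists>y. (h has_real_derivative y) (at x) \<and> y \<ge> 0"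
        by blast
    qed (use a in auto)
    moreover have "h z = 0"
      using z z' by (simp add: h_def E_def)
    ultimately have "E a \<le> 0"
      by (simp add: h_def mult_le_0_iff)
    then show ?thesis
      by (simp add: E_def sum_power2_le_zero_iff)
  qed
  have "?F \<midarrow>0\<rightarrow> ?F 0"
    using continuous_on_bessel_clifford[of UNIV \<nu>] by (simp add: continuous_on_def)
  then have "(?F \<longlongrightarrow> ?F 0) (at_right 0)"
    by (rule filterlim_mono) (simp_all add: at_le)
  moreover have "(?F \<longlongrightarrow> 0) (at_right 0)"
    by (rule tendsto_eventually, rule eventually_at_rightI[of 0 z]) (use F0 z in auto)
  ultimately have "?F 0 = 0"
    by (rule tendsto_unique[rotated]) simp
  then show False
    using bessel_clifford_0_neq_0[OF \<nu>] by simp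
qed

text \<open>The algebra behind the equation for \<open>u\<close> below: \<open>X\<close> stands for
  \<open>x powr p\<close>, \<open>F0\<close> and \<open>F1\<close> for the orders \<nu> and
  \<open>\<nu> + 1\<close> at \<open>x\<^sup>2 / 4\<close>, and order \<open>\<nu> + 2\<close> is
  already eliminated. The coefficient of \<open>X * F1\<close> is
  \<open>- p/2 - (p + 1)/2 + \<nu> + 1\<close>, which vanishes exactly when
  \<open>p = \<nu> + 1/2\<close>.\<close>

lemma liouville_normal_form:
  fixes x :: real
  assumes x: "x > 0" and p: "\<nu> = p - 1/2"
  shows "\<sigma> * (p * ((p - 1) * (X / x\<^sup>2)) * F0 + p * (X / x) * (- F1 * (x / 2))
        - ((p + 1) * X * F1 + X * x * (- (((\<nu> + 1) * F1 - F0) * 4 / x\<^sup>2) * (x / 2))) / 2) =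
        - (1 + (1/4 - \<nu>\<^sup>2) / x\<^sup>2) * (\<sigma> * (X * F0))"
proof -
  have 1: "X * x * (- (((\<nu> + 1) * F1 - F0) * 4 / x\<^sup>2) * (x / 2)) = - 2 * X * ((\<nu> + 1) * F1 - F0)"
    and 2: "p * (X / x) * (- F1 * (x / 2)) = - p * X * F1 / 2"
    using x by (simp_all add: power2_eq_square)
  have 3: "p * (p - 1) = - (1/4 - \<nu>\<^sup>2)"
    unfolding p by (simp add: power2_eq_square algebra_simps)
  have 4: "p * ((p - 1) * (X / x\<^sup>2)) = - ((1/4 - \<nu>\<^sup>2) / x\<^sup>2) * X"
  proof -
    have "p * ((p - 1) * (X / x\<^sup>2)) = p * (p - 1) * X / x\<^sup>2" by simp
    also have "\<dots> = - ((1/4 - \<nu>\<^sup>2) / x\<^sup>2) * X"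
      unfolding 3 by (simp add: algebra_simps diff_divide_distrib add_divide_distrib)
    finally show ?thesis .
  qed
  define q where "q = (1/4 - \<nu>\<^sup>2) / x\<^sup>2"
  have v: "p = \<nu> + 1/2" using p by simp
  show ?thesis unfolding 1 2 4 q_def[symmetric] unfolding v by (simp add: field_simps)
qed

text \<open>Sturm comparison: \<open>u(x) = x\<^bsup>\<nu> + 1/2\<^esup> F(x\<^sup>2/4)\<close> satisfies
  \<open>u'' + (1 + (1/4 - \<nu>\<^sup>2)/x\<^sup>2) u = 0\<close>, where the potential eventually exceeds \<open>1/4\<close>;
  compare with \<open>sin((x - a)/2)\<close>.\<close>

lemma bessel_clifford_no_constant_sign:
  fixes \<sigma> :: real
  assumes \<sigma>: "\<sigma> \<noteq> 0" and a: "a \<ge> 1" "a \<ge> \<bar>\<nu>\<bar> * 2"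
  shows "\<exists>x\<in>{a..a + 2 * pi}. \<sigma> * bessel_clifford \<nu> (x\<^sup>2 / 4) \<le> 0"
proof (rule ccontr)
  assume "\<not> ?thesis"
  then have pos: "\<sigma> * bessel_clifford \<nu> (x\<^sup>2 / 4) > 0" if "x \<in> {a..a + 2 * pi}" for x
    using that by (meson not_le)
  define p where "p = \<nu> + 1 / 2"
  define F where "F i x = bessel_clifford (\<nu> + i) (x\<^sup>2 / 4)" for i x
  have dF: "(F i has_real_derivative - F (i + 1) x * (x / 2)) (at x)" for i x
  proof -
    have "((\<lambda>x. x\<^sup>2 / 4) has_real_derivative x / 2) (at x)"
      by (auto intro!: derivative_eq_intros)
    from DERIV_chain2[OF DERIV_bessel_clifford this, of "\<nu> + i"] show ?thesis
      unfolding F_def[abs_def] by (simp add: add_ac)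
  qed
  define u where "u x = \<sigma> * (x powr p * F 0 x)" for x
  define u' where "u' x = \<sigma> * (p * x powr (p - 1) * F 0 x - x powr (p + 1) * F 1 x / 2)" for x
  have du: "(u has_real_derivative u' x) (at x)" if "x > 0" for x
    unfolding u_def[abs_def] u'_def using that
    by (auto intro!: derivative_eq_intros dF[of 0, simplified] simp: algebra_simps powr_add)
  have du': "(u' has_real_derivative - (1 + (1/4 - \<nu>\<^sup>2) / x\<^sup>2) * u x) (at x)" if x: "x > 0" for x
  proof -
    have "x\<^sup>2 / 4 * F 2 x - (\<nu> + 1) * F 1 x + F 0 x = 0"
      using bessel_clifford_recurrence[of "x\<^sup>2 / 4" \<nu>] by (simp add: F_def)
    then have F2: "F 2 x = ((\<nu> + 1) * F 1 x - F 0 x) * 4 / x\<^sup>2"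
      using x by (simp add: field_simps)
    have pw: "x powr (p + 1) = x powr p * x" "x powr (p - 1) = x powr p / x"
      "x powr (p - 1 - 1) = x powr p / x\<^sup>2"
      using x by (simp_all add: powr_add powr_diff power2_eq_square)
    have "(u' has_real_derivative \<sigma> * (p * ((p - 1) * x powr (p - 1 - 1)) * F 0 x
        + p * x powr (p - 1) * (- F 1 x * (x / 2))
        - ((p + 1) * x powr p * F 1 x + x powr (p + 1) * (- F 2 x * (x / 2))) / 2)) (at x)"
      unfolding u'_def[abs_def] using x
      by (auto intro!: derivative_eq_intros dF[of 0, simplified] dF[of 1, simplified] simp: field_simps)
    also have "\<sigma> * (p * ((p - 1) * x powr (p - 1 - 1)) * F 0 x
        + p * x powr (p - 1) * (- F 1 x * (x / 2))
        - ((p + 1) * x powr p * F 1 x + x powr (p + 1) * (- F 2 x * (x / 2))) / 2) =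
        - (1 + (1/4 - \<nu>\<^sup>2) / x\<^sup>2) * u x"
      unfolding pw F2 u_def by (rule liouville_normal_form) (simp_all add: p_def x)
    finally show ?thesis .
  qed
  have upos: "u x > 0" if "x \<in> {a..a + 2 * pi}" for x
  proof -
    have "x powr p * (\<sigma> * bessel_clifford \<nu> (x\<^sup>2 / 4)) > 0"
      using that a(1) by (intro mult_pos_pos[OF _ pos[OF that]]) auto
    then show ?thesis by (simp add: u_def F_def mult_ac)
  qed
  \<comment> \<open>The Wronskian of \<open>u\<close> with the comparison solution, whose half
    period \<open>2 * pi\<close> fixes the length of the window. Its derivative is
    \<open>1/4\<close> minus the potential, times \<open>u\<close> and the sine, hence nonpositive;
    yet \<open>W\<close> would rise from \<open>- u a / 2\<close> to
    \<open>u (a + 2 * pi) / 2\<close>.\<close>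
  define W where "W x = u' x * sin ((x - a) / 2) - u x * (cos ((x - a) / 2) / 2)" for x
  have "W (a + 2 * pi) \<le> W a"
  proof (rule DERIV_nonpos_imp_nonincreasing[of a "a + 2 * pi" W])
    fix x assume x: "a \<le> x" "x \<le> a + 2 * pi"
    have x0: "x > 0" using a x by linarith
    have u0: "u x > 0"
      using upos x by simp
    have s0: "sin ((x - a) / 2) \<ge> 0"
      using x by (intro sin_ge_zero) auto
    \<comment> \<open>The bound \<open>2 * \<bar>\<nu>\<bar> \<le> a\<close> makes
      \<open>\<nu>\<^sup>2 / x\<^sup>2\<close> at most \<open>1/4\<close>, so the potential is even
      at least \<open>3/4\<close>.\<close>
    have q: "1 + (1/4 - \<nu>\<^sup>2) / x\<^sup>2 \<ge> 1/4"
    proof -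
      have "\<bar>2 * \<nu>\<bar> \<le> \<bar>x\<bar>" using a x by linarith
      then have "4 * \<nu>\<^sup>2 \<le> x\<^sup>2"
        using abs_le_square_iff[of "2 * \<nu>" x] by (simp add: power_mult_distrib)
      then have "16 * \<nu>\<^sup>2 \<le> 4 + 12 * x\<^sup>2"
        using zero_le_power2[of \<nu>] by linarith
      then show ?thesis using x0 by (simp add: field_simps)
    qed
    have "(W has_real_derivative (1/4 - (1 + (1/4 - \<nu>\<^sup>2) / x\<^sup>2)) * u x * sin ((x - a) / 2)) (at x)"
      unfolding W_def[abs_def]
      by (auto intro!: derivative_eq_intros du[OF x0] du'[OF x0] simp: field_simps)
    moreover have "(1/4 - (1 + (1/4 - \<nu>\<^sup>2) / x\<^sup>2)) * u x * sin ((x - a) / 2) \<le> 0"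
    proof -
      have "1/4 - (1 + (1/4 - \<nu>\<^sup>2) / x\<^sup>2) \<le> 0" using q by linarith
      then show ?thesis using u0 s0 by (simp only: mult_nonpos_nonneg less_imp_le)
    qed
    ultimately show "\<exists>y. (W has_real_derivative y) (at x) \<and> y \<le> 0"
      by blast
  qed simp
  moreover have "W (a + 2 * pi) = u (a + 2 * pi) / 2" "W a = - u a / 2"
    by (simp_all add: W_def)
  moreover have "u a > 0" "u (a + 2 * pi) > 0"
    using upos[of a] upos[of "a + 2 * pi"] by simp_all
  ultimately show False by linarith
qed

text \<open>With \<sigma> equal to \<open>1\<close> and to \<open>-1\<close> on one window, the
  function takes values of both weak signs there, and connectedness yields a zero. The window starts
  so far out that \<open>w \<ge> a\<close> gives
  \<open>w\<^sup>2 / 4 \<ge> (\<bar>R\<bar> + 1)\<^sup>2 > R\<close>.\<close>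

lemma bessel_clifford_zero_beyond: "\<exists>z>R. bessel_clifford \<nu> z = 0"
proof -
  define a where "a = max (\<bar>\<nu>\<bar> * 2) (2 * \<bar>R\<bar> + 2)"
  have a: "a \<ge> 1" "a \<ge> \<bar>\<nu>\<bar> * 2" "a \<ge> 2 * \<bar>R\<bar> + 2"
    by (auto simp: a_def)
  let ?f = "\<lambda>x. bessel_clifford \<nu> (x\<^sup>2 / 4)"
  obtain x y where xy: "x \<in> {a..a + 2 * pi}" "?f x \<le> 0" "y \<in> {a..a + 2 * pi}" "?f y \<ge> 0"
    using bessel_clifford_no_constant_sign[of 1 a \<nu>] bessel_clifford_no_constant_sign[of "-1" a \<nu>] a
    by auto
  have "connected (?f ` {a..a + 2 * pi})"
    by (intro connected_continuous_image continuous_on_compose2[OF continuous_on_bessel_clifford[of UNIV]]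
          continuous_intros) auto
  then have "0 \<in> ?f ` {a..a + 2 * pi}"
    by (rule connectedD_interval[OF _ imageI[OF xy(1)] imageI[OF xy(3)] xy(2,4)])
  then obtain w where w: "w \<ge> a" "?f w = 0" by auto
  have "w\<^sup>2 / 4 > R"
  proof -
    have "(2 * \<bar>R\<bar> + 2)\<^sup>2 \<le> w\<^sup>2"
      using a w by (intro power_mono) auto
    moreover have "(2 * \<bar>R\<bar> + 2)\<^sup>2 = 4 * \<bar>R\<bar>\<^sup>2 + 8 * \<bar>R\<bar> + 4"
      by (simp add: power2_sum power_mult_distrib)
    moreover have "\<bar>R\<bar>\<^sup>2 \<ge> 0" by simp
    ultimately show ?thesis by linarith
  qed
  with w show ?thesis by blast
qed

subsection \<open>Convergence of zeros\<close>

text \<open>Infinitely many zeros would accumulate at some \<open>l\<close> by compactness; along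
  them both \<open>f\<close> and its difference quotient at \<open>l\<close> vanish, so
  \<open>l\<close> would be a multiple zero.\<close>

lemma finite_simple_zeros:
  fixes f f' :: "real \<Rightarrow> real"
  assumes df: "\<And>x. x \<in> {a..b} \<Longrightarrow> (f has_real_derivative f' x) (at x)"
    and simple: "\<And>x. x \<in> {a..b} \<Longrightarrow> f x = 0 \<Longrightarrow> f' x \<noteq> 0"
  shows "finite {x \<in> {a..b}. f x = 0}"
proof (rule ccontr)
  assume "infinite {x \<in> {a..b}. f x = 0}"
  then obtain l where l: "l \<in> {a..b}" "l islimpt {x \<in> {a..b}. f x = 0}"
    using Heine_Borel_imp_Bolzano_Weierstrass[OF compact_Icc[of a b], of "{x \<in> {a..b}. f x = 0}"]
    by blast
  let ?Z = "{x \<in> {a..b}. f x = 0}"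
  have nb: "at l within ?Z \<noteq> bot"
    using l(2) by (simp add: trivial_limit_within)
  have le: "at l within ?Z \<le> at l"
    by (rule at_le) simp
  have ev: "eventually (\<lambda>x. f x = 0) (at l within ?Z)"
    by (simp add: eventually_at_filter)
  have "isCont f l" using df[OF l(1)] by (rule DERIV_isCont)
  then have "(f \<longlongrightarrow> f l) (at l within ?Z)"
    unfolding isCont_def by (rule tendsto_mono[OF le])
  moreover have "(f \<longlongrightarrow> 0) (at l within ?Z)"
    using ev by (rule tendsto_eventually)
  ultimately have fl: "f l = 0" using nb tendsto_unique by blast
  have "((\<lambda>x. (f x - f l) / (x - l)) \<longlongrightarrow> f' l) (at l within ?Z)"
    using df[OF l(1)] unfolding has_field_derivative_iff by (rule tendsto_mono[OF le])
  moreover have "((\<lambda>x. (f x - f l) / (x - l)) \<longlongrightarrow> 0) (at l within ?Z)"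
    by (rule tendsto_eventually) (use ev fl in \<open>auto elim: eventually_mono\<close>)
  ultimately have "f' l = 0" using nb tendsto_unique by blast
  then show False using simple[OF l(1) fl] by simp
qed

lemma unique_zero_if_deriv_nonzero:
  fixes f f' :: "real \<Rightarrow> real"
  assumes df: "\<And>x. x \<in> {a..b} \<Longrightarrow> (f has_real_derivative f' x) (at x)"
    and nz: "\<And>x. x \<in> {a..b} \<Longrightarrow> f' x \<noteq> 0"
    and sgn: "f a * f b < 0" and ab: "a \<le> b"
  shows "\<exists>!x. x \<in> {a..b} \<and> f x = 0"
proof (rule ex_ex1I)
  have cont: "continuous_on {a..b} f"
    by (meson continuous_at_imp_continuous_on df DERIV_isCont)
  show "\<exists>x. x \<in> {a..b} \<and> f x = 0"
  proof (cases "f a < 0")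
    case True
    then have "f b > 0" using sgn by (simp add: mult_less_0_iff)
    then show ?thesis using IVT'[of f a 0 b] True cont ab by auto
  next
    case False
    then have "f a > 0" "f b < 0" using sgn by (auto simp: mult_less_0_iff)
    then show ?thesis using IVT2'[of f b 0 a] cont ab by auto
  qed
  have no: False if xy: "x \<in> {a..b}" "y \<in> {a..b}" "f x = 0" "f y = 0" "x < y" for x y
  proof -
    obtain w where "w > x" "w < y" "f y - f x = (y - x) * f' w"
      using MVT2[of x y f f'] df xy
      by (metis (full_types) atLeastAtMost_iff order.trans)
    then show False using nz[of w] xy by auto
  qed
  show "x = y" if "x \<in> {a..b} \<and> f x = 0" "y \<in> {a..b} \<and> f y = 0" for x y
    using that no[of x y] no[of y x] by (metis linorder_neqE)
qed

text \<open>On a compact set \<open>\<bar>F\<bar>\<close> has a positive minimum, and a function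
  closer to \<open>F\<close> than that shares its sign. The product form keeps the sign and not only
  the nonvanishing, as needed at the ends of the isolating intervals below.\<close>

lemma eventually_nonzero_uniform_limit:
  fixes f :: "'a \<Rightarrow> real \<Rightarrow> real"
  assumes lim: "uniform_limit S f F net" and K: "compact K" "K \<subseteq> S"
    and F: "continuous_on K F" "\<And>x. x \<in> K \<Longrightarrow> F x \<noteq> 0"
  shows "eventually (\<lambda>n. \<forall>x\<in>K. F x * f n x > 0) net"
proof (cases "K = {}")
  case False
  have "continuous_on K (\<lambda>x. \<bar>F x\<bar>)"
    using F(1) by (intro continuous_intros)
  from continuous_attains_inf[OF K(1) False this]
  obtain x0 where x0: "x0 \<in> K" "\<And>x. x \<in> K \<Longrightarrow> \<bar>F x0\<bar> \<le> \<bar>F x\<bar>"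
    by blast
  have "\<bar>F x0\<bar> > 0" using F x0 by simp
  with lim have "eventually (\<lambda>n. \<forall>x\<in>S. dist (f n x) (F x) < \<bar>F x0\<bar>) net"
    by (rule uniform_limitD)
  then show ?thesis
  proof eventually_elim
    case (elim n)
    show ?case
    proof
      fix x assume x: "x \<in> K"
      then have "\<bar>f n x - F x\<bar> < \<bar>F x\<bar>"
        using elim K(2) x0(2)[OF x] by (fastforce simp: dist_real_def)
      then show "F x * f n x > 0"
        by (auto simp: zero_less_mult_iff abs_if split: if_splits)
    qed
  qed
qed simp

text \<open>A real version of Hurwitz's theorem; convergence of derivatives replaces holomorphy.\<close>

lemma eventually_card_zeros_eq:
  fixes f f' :: "'a \<Rightarrow> real \<Rightarrow> real"
  assumes df: "\<And>n x. (f n has_real_derivative f' n x) (at x)"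
    and dF: "\<And>x. (F has_real_derivative F' x) (at x)"
    and cF': "continuous_on {0..R} F'"
    and lim: "uniform_limit {0..R} f F net"
    and lim': "uniform_limit {0..R} f' F' net"
    and simple: "\<And>x. x \<in> {0..R} \<Longrightarrow> F x = 0 \<Longrightarrow> F' x \<noteq> 0"
    and F0: "F 0 \<noteq> 0" and FR: "F R \<noteq> 0" and R: "R > 0"
  shows "eventually (\<lambda>n. finite {y. 0 < y \<and> y \<le> R \<and> f n y = 0} \<and>
           card {y. 0 < y \<and> y \<le> R \<and> f n y = 0} = card {y. 0 < y \<and> y \<le> R \<and> F y = 0}) net"
proof -
  define Z where "Z = {x \<in> {0..R}. F x = 0}"
  have finZ: "finite Z"
    unfolding Z_def using dF simple by (rule finite_simple_zeros)
  have Zeq: "{y. 0 < y \<and> y \<le> R \<and> F y = 0} = Z"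
    using F0 by (auto simp: Z_def less_le)
  have cF: "continuous_on A F" for A
    by (meson continuous_at_imp_continuous_on dF DERIV_isCont)
  \<comment> \<open>Since \<open>F\<close> is nonzero at \<open>0\<close> and \<open>R\<close>, its
    zeros are interior and leave room for \<open>d\<close>. The factor 2 makes intervals around
    different zeros disjoint: a common point would bound \<open>\<bar>y - z\<bar>\<close> by the sum
    of the two radii.\<close>
  have ex: "\<exists>d>0. {z - d..z + d} \<subseteq> {0<..<R} \<and> (\<forall>x\<in>{z - d..z + d}. F' x \<noteq> 0) \<and>
       (\<forall>y\<in>Z. y \<noteq> z \<longrightarrow> 2 * d < \<bar>y - z\<bar>)" if z: "z \<in> Z" for z
  proof -
    have zR: "0 < z" "z < R" "F z = 0" "F' z \<noteq> 0"
      using z F0 FR simple[of z] by (auto simp: Z_def less_le)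
    have "isCont F' z"
      using cF' zR by (intro continuous_on_interior[of "{0..R}"]) auto
    then obtain d1 where d1: "d1 > 0" "\<And>x. dist z x < d1 \<Longrightarrow> F' x \<noteq> 0"
      using continuous_at_avoid[of z F' 0] zR(4) by blast
    obtain d2 where d2: "d2 > 0" "\<And>y. y \<in> Z \<Longrightarrow> y \<noteq> z \<Longrightarrow> d2 \<le> dist z y"
      using finite_set_avoid[OF finZ, of z] by blast
    define d where "d = min (min (d1 / 2) (d2 / 3)) (min (z / 2) ((R - z) / 2))"
    have "d > 0"
      using d1 d2 zR by (simp add: d_def)
    moreover have "d \<le> d1 / 2" "d \<le> d2 / 3" "d \<le> z / 2" "d \<le> (R - z) / 2"
      unfolding d_def by linarith+
    ultimately have d: "d > 0" "d \<le> d1 / 2" "d \<le> d2 / 3" "d \<le> z / 2" "d \<le> (R - z) / 2"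
      by simp_all
    have "F' x \<noteq> 0" if "x \<in> {z - d..z + d}" for x
      using that d d1 by (intro d1(2)) (auto simp: dist_real_def)
    moreover have "{z - d..z + d} \<subseteq> {0<..<R}"
      using d zR by auto
    moreover have "2 * d < \<bar>y - z\<bar>" if "y \<in> Z" "y \<noteq> z" for y
      using d2(2)[OF that] d d2(1) by (auto simp: dist_real_def)
    ultimately show ?thesis using d(1) by blast
  qed
  then obtain d where d: "\<And>z. z \<in> Z \<Longrightarrow> d z > 0"
     "\<And>z. z \<in> Z \<Longrightarrow> {z - d z..z + d z} \<subseteq> {0<..<R}"
     "\<And>z x. z \<in> Z \<Longrightarrow> x \<in> {z - d z..z + d z} \<Longrightarrow> F' x \<noteq> 0"
     "\<And>z y. z \<in> Z \<Longrightarrow> y \<in> Z \<Longrightarrow> y \<noteq> z \<Longrightarrow> 2 * d z < \<bar>y - z\<bar>"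
    by metis
  define I where "I z = {z - d z..z + d z}" for z
  \<comment> \<open>Only open intervals are removed, so \<open>K\<close> is compact and still
    contains the end points \<open>z - d z\<close> and \<open>z + d z\<close>. One estimate on
    \<open>K\<close> then excludes zeros outside the intervals and fixes the signs at their
    ends.\<close>
  define K where "K = {0..R} - (\<Union>z\<in>Z. {z - d z<..<z + d z})"
  have disj: "I y \<inter> I z = {}" if "y \<in> Z" "z \<in> Z" "y \<noteq> z" for y z
  proof (rule ccontr)
    assume "I y \<inter> I z \<noteq> {}"
    then obtain x where x: "x \<in> I y" "x \<in> I z" by blast
    have "\<bar>x - y\<bar> \<le> d y" "\<bar>x - z\<bar> \<le> d z"
      using x unfolding I_def abs_le_iff by auto
    moreover have "2 * d y < \<bar>z - y\<bar>" "2 * d z < \<bar>y - z\<bar>"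
      using d(4)[of y z] d(4)[of z y] that by auto
    ultimately show False by linarith
  qed
  have "compact K"
    unfolding K_def by (intro compact_diff open_UN) auto
  moreover have "F x \<noteq> 0" if "x \<in> K" for x
  proof
    assume "F x = 0"
    then have x: "x \<in> Z" using that by (simp add: K_def Z_def)
    then have "x \<in> {x - d x<..<x + d x}" using d(1) by simp
    then show False using that x unfolding K_def by blast
  qed
  ultimately have ev1: "eventually (\<lambda>n. \<forall>x\<in>K. F x * f n x > 0) net"
    by (intro eventually_nonzero_uniform_limit[OF lim] cF) (auto simp: K_def)
  have subI: "I z \<subseteq> {0..R}" if "z \<in> Z" for z
    unfolding I_def by (rule order.trans[OF d(2)[OF that]]) auto
  have "compact (\<Union>z\<in>Z. I z)"
    using finZ by (intro compact_UN) (auto simp: I_def)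
  moreover have sub: "(\<Union>z\<in>Z. I z) \<subseteq> {0..R}"
    using subI by blast
  moreover have "F' x \<noteq> 0" if "x \<in> (\<Union>z\<in>Z. I z)" for x
    using that d(3) by (auto simp: I_def)
  ultimately have ev2: "eventually (\<lambda>n. \<forall>x\<in>(\<Union>z\<in>Z. I z). F' x * f' n x > 0) net"
    by (intro eventually_nonzero_uniform_limit[OF lim'] continuous_on_subset[OF cF'])
  \<comment> \<open>On \<open>I z\<close> the continuous \<open>F'\<close> has no zero and hence one
    sign, so by the mean value theorem \<open>F\<close> changes sign across its zero
    \<open>z\<close>.\<close>
  have sgnF: "F (z - d z) * F (z + d z) < 0" if z: "z \<in> Z" for z
  proof -
    have Fz: "F z = 0" using z by (simp add: Z_def)
    have dz: "d z > 0" using d(1) z .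
    obtain v where v: "v > z - d z" "v < z" "F z - F (z - d z) = (z - (z - d z)) * F' v"
      using MVT2[of "z - d z" z F F'] dF dz by auto
    obtain w where w: "w > z" "w < z + d z" "F (z + d z) - F z = (z + d z - z) * F' w"
      using MVT2[of z "z + d z" F F'] dF dz by auto
    have "F' v * F' w > 0"
    proof (rule ccontr)
      assume neg: "\<not> F' v * F' w > 0"
      have "connected (F' ` I z)"
        using subI[OF z] by (intro connected_continuous_image continuous_on_subset[OF cF'])
          (simp_all add: I_def)
      moreover have "F' v \<in> F' ` I z" "F' w \<in> F' ` I z"
        using v w by (auto simp: I_def)
      moreover have "F' v \<le> 0 \<and> 0 \<le> F' w \<or> F' w \<le> 0 \<and> 0 \<le> F' v"
        using neg by (auto simp: zero_less_mult_iff)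
      ultimately have "0 \<in> F' ` I z"
        by (meson connectedD_interval)
      then show False using d(3)[OF z] by (auto simp: I_def)
    qed
    then have "(d z)\<^sup>2 * (F' v * F' w) > 0" using dz by simp
    moreover have "F (z - d z) = - (d z * F' v)" "F (z + d z) = d z * F' w"
      using v(3) w(3) Fz by simp_all
    ultimately show ?thesis by (simp add: power2_eq_square algebra_simps)
  qed
  have ends: "z - d z \<in> K" "z + d z \<in> K" if z: "z \<in> Z" for z
  proof -
    have "z - d z \<in> I z" "z + d z \<in> I z" using d(1)[OF z] by (auto simp: I_def)
    moreover have "x \<in> K" if x: "x \<in> I z" "x \<notin> {z - d z<..<z + d z}" for x
    proof -
      have "x \<notin> {y - d y<..<y + d y}" if y: "y \<in> Z" for y
      proof (cases "y = z")
        case False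
        then have "x \<notin> I y" using disj[OF y z] x by blast
        then show ?thesis by (auto simp: I_def)
      qed (use x in simp)
      moreover have "x \<in> {0..R}" using sub z x by blast
      ultimately show ?thesis by (simp add: K_def)
    qed
    ultimately show "z - d z \<in> K" "z + d z \<in> K" by auto
  qed
  from ev1 ev2 have "eventually (\<lambda>n. finite {y. 0 < y \<and> y \<le> R \<and> f n y = 0} \<and>
           card {y. 0 < y \<and> y \<le> R \<and> f n y = 0} = card Z) net"
  proof eventually_elim
    case (elim n)
    have uni: "\<exists>!x. x \<in> I z \<and> f n x = 0" if z: "z \<in> Z" for z
      unfolding I_def
    proof (rule unique_zero_if_deriv_nonzero[OF df])
      show "f' n x \<noteq> 0" if "x \<in> {z - d z..z + d z}" for x
      proof -
        have "x \<in> (\<Union>z\<in>Z. I z)" using z that by (auto simp: I_def)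
        then have "F' x * f' n x > 0" using elim(2) by blast
        then show ?thesis by auto
      qed
      \<comment> \<open>At each end \<open>f n\<close> has the sign of \<open>F\<close>, so it
        inherits the sign change.\<close>
      have "(F (z - d z) * f n (z - d z)) * (F (z + d z) * f n (z + d z)) > 0"
        using elim(1) ends[OF z] mult_pos_pos by blast
      then have "(F (z - d z) * F (z + d z)) * (f n (z - d z) * f n (z + d z)) > 0"
        by (simp add: algebra_simps)
      then show "f n (z - d z) * f n (z + d z) < 0"
        using sgnF[OF z] zero_less_mult_iff[of "F (z - d z) * F (z + d z)"
            "f n (z - d z) * f n (z + d z)"] by linarith
    qed (use d(1)[OF z] in simp)
    have "\<forall>z\<in>Z. \<exists>w. {x \<in> I z. f n x = 0} = {w}"
    proof
      fix z assume "z \<in> Z"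
      from uni[OF this] obtain w where "w \<in> I z \<and> f n w = 0"
        "\<And>x. x \<in> I z \<and> f n x = 0 \<Longrightarrow> x = w" by (rule ex1E) blast
      then have "{x \<in> I z. f n x = 0} = {w}" by blast
      then show "\<exists>w. {x \<in> I z. f n x = 0} = {w}" ..
    qed
    from bchoice[OF this] obtain g where g: "\<And>z. z \<in> Z \<Longrightarrow> {x \<in> I z. f n x = 0} = {g z}"
      by blast
    have eq: "{y. 0 < y \<and> y \<le> R \<and> f n y = 0} = g ` Z"
    proof (intro equalityI subsetI)
      fix y assume y: "y \<in> {y. 0 < y \<and> y \<le> R \<and> f n y = 0}"
      then have "y \<notin> K" using elim(1) by auto
      then obtain z where z: "z \<in> Z" "y \<in> I z"
        using y by (auto simp: K_def I_def less_imp_le)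
      then have "y \<in> {x \<in> I z. f n x = 0}" using y by simp
      then show "y \<in> g ` Z" using g[OF z(1)] z(1) by simp
    next
      fix y assume "y \<in> g ` Z"
      then obtain z where z: "z \<in> Z" "y = g z" by blast
      then have "y \<in> {x \<in> I z. f n x = 0}" using g by simp
      then show "y \<in> {y. 0 < y \<and> y \<le> R \<and> f n y = 0}"
        using d(2)[OF z(1)] by (auto simp: I_def)
    qed
    have "inj_on g Z"
    proof (rule inj_onI, rule ccontr)
      fix y z assume yz: "y \<in> Z" "z \<in> Z" "g y = g z" "y \<noteq> z"
      have "g y \<in> I y" "g z \<in> I z" using g yz by blast+
      then show False using disj[OF yz(1,2,4)] yz(3) by auto
    qed
    then show ?case unfolding eq using finZ by (simp add: card_image)
  qed
  then show ?thesis unfolding Zeq .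
qed

text \<open>The two counts differ by one, so exactly one zero lies in \<open>(a, b]\<close>, and the
  zeros up to it are all those up to \<open>b\<close>. This turns convergence of the
  \<open>k\<close>th zero into two counting statements.\<close>

lemma is_pos_zero_if_counts:
  assumes "0 < k" and "a \<ge> 0" and "a < b"
    and fin: "finite {y. 0 < y \<and> y \<le> b \<and> f y = 0}"
    and ca: "card {y. 0 < y \<and> y \<le> a \<and> f y = 0} = k - 1"
    and cb: "card {y. 0 < y \<and> y \<le> b \<and> f y = 0} = k"
  shows "\<exists>x. is_pos_zero f k x \<and> a < x \<and> x \<le> b"
proof -
  let ?A = "{y. 0 < y \<and> y \<le> a \<and> f y = 0}" and ?B = "{y. 0 < y \<and> y \<le> b \<and> f y = 0}"
  have sub: "?A \<subseteq> ?B" using \<open>a < b\<close> by auto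
  then have "card (?B - ?A) = 1"
    using fin ca cb \<open>0 < k\<close> by (simp add: card_Diff_subset finite_subset)
  then obtain x where x: "?B - ?A = {x}" by (rule card_1_singletonE)
  have "x \<in> ?B - ?A" unfolding x by simp
  note xB = DiffD1[OF this] and xA = DiffD2[OF this]
  have "a < x"
    by (rule ccontr) (use xB xA in auto)
  have "{y. 0 < y \<and> y \<le> x \<and> f y = 0} = ?B"
  proof (intro equalityI subsetI)
    fix y assume y: "y \<in> ?B"
    show "y \<in> {y. 0 < y \<and> y \<le> x \<and> f y = 0}"
    proof (cases "y \<in> ?A")
      case True then show ?thesis using \<open>a < x\<close> by auto
    next
      case False
      then have "y \<in> ?B - ?A" using y by simp
      then have "y = x" unfolding x by simp
      then show ?thesis using y by simp
    qed
  qed (use xB in auto)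
  then have "is_pos_zero f k x"
    using xB fin cb by (simp add: is_pos_zero_def)
  then show ?thesis using \<open>a < x\<close> xB by auto
qed

lemma eventually_is_pos_zero_near:
  fixes f f' :: "'a \<Rightarrow> real \<Rightarrow> real"
  assumes df: "\<And>n x. (f n has_real_derivative f' n x) (at x)"
    and dF: "\<And>x. (F has_real_derivative F' x) (at x)"
    and cF': "\<And>R. continuous_on {0..R} F'"
    and lim: "\<And>R. uniform_limit {0..R} f F net"
    and lim': "\<And>R. uniform_limit {0..R} f' F' net"
    and simple: "\<And>x. x > 0 \<Longrightarrow> F x = 0 \<Longrightarrow> F' x \<noteq> 0"
    and F0: "F 0 \<noteq> 0" and z: "is_pos_zero F k z" and e: "e > 0"
  shows "eventually (\<lambda>n. \<exists>x. is_pos_zero (f n) k x \<and> dist x z < e) net"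
proof -
  have z0: "z > 0" "F z = 0" and fz: "finite {y. 0 < y \<and> y \<le> z \<and> F y = 0}"
    and kz: "card {y. 0 < y \<and> y \<le> z \<and> F y = 0} = k"
    using z by (auto simp: is_pos_zero_def)
  have simple': "F' x \<noteq> 0" if "x \<in> {0..R}" "F x = 0" for x R
    using that F0 simple[of x] by (cases "x = 0") auto
  define Z where "Z = {x \<in> {0..z + 1}. F x = 0}"
  have "finite Z"
    unfolding Z_def using dF simple' by (rule finite_simple_zeros)
  then obtain d0 where d0: "d0 > 0" "\<And>y. y \<in> Z \<Longrightarrow> y \<noteq> z \<Longrightarrow> d0 \<le> dist z y"
    using finite_set_avoid[of Z z] by blast
  \<comment> \<open>\<open>d0 / 2\<close> isolates \<open>z\<close> from the other zeros,
    \<open>z / 2\<close> keeps \<open>z - d\<close> positive, \<open>1 / 2\<close> keeps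
    \<open>z + d\<close> in the interval on which \<open>d0\<close> was obtained, and
    \<open>e / 2\<close> gives the required closeness.\<close>
  define d where "d = min (min (d0 / 2) (z / 2)) (min (1 / 2) (e / 2))"
  have d: "d > 0" using d0 z0 e by (simp add: d_def)
  have d': "d \<le> d0 / 2" "d \<le> z / 2" "d \<le> 1 / 2" "d \<le> e / 2"
    unfolding d_def by linarith+
  have only: "y = z" if "F y = 0" "z - d \<le> y" "y \<le> z + d" for y
  proof (rule ccontr)
    assume "y \<noteq> z"
    moreover have "y \<in> Z" using that d d' z0 by (simp add: Z_def)
    ultimately have "d0 \<le> \<bar>z - y\<bar>" using d0(2) by (simp add: dist_real_def)
    then show False using that d d' d0(1) by linarith
  qed
  have b: "{y. 0 < y \<and> y \<le> z + d \<and> F y = 0} = {y. 0 < y \<and> y \<le> z \<and> F y = 0}"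
    using only d by fastforce
  have a: "{y. 0 < y \<and> y \<le> z - d \<and> F y = 0} = {y. 0 < y \<and> y \<le> z \<and> F y = 0} - {z}"
    using only d by fastforce
  have "z \<in> {y. 0 < y \<and> y \<le> z \<and> F y = 0}" using z0 by simp
  then have k: "k > 0" using fz kz by (metis card_gt_0_iff empty_iff)
  have card_a: "card {y. 0 < y \<and> y \<le> z - d \<and> F y = 0} = k - 1"
    unfolding a using z0 fz kz by (simp add: card_Diff_singleton)
  have card_b: "card {y. 0 < y \<and> y \<le> z + d \<and> F y = 0} = k"
    unfolding b by (rule kz)
  have ne: "F (z - d) \<noteq> 0" "F (z + d) \<noteq> 0"
    using only[of "z - d"] only[of "z + d"] d by auto
  have count: "eventually (\<lambda>n. finite {y. 0 < y \<and> y \<le> R \<and> f n y = 0} \<and>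
           card {y. 0 < y \<and> y \<le> R \<and> f n y = 0} = card {y. 0 < y \<and> y \<le> R \<and> F y = 0}) net"
    if "F R \<noteq> 0" "R > 0" for R
    using df dF cF' lim lim' simple' F0 that by (rule eventually_card_zeros_eq)
  have pos: "z - d > 0" "z + d > 0" using d d' z0 by linarith+
  from count[OF ne(1) pos(1)] count[OF ne(2) pos(2)] show ?thesis
  proof eventually_elim
    case (elim n)
    have "\<exists>x. is_pos_zero (f n) k x \<and> z - d < x \<and> x \<le> z + d"
      by (rule is_pos_zero_if_counts[OF k]) (use elim card_a card_b d pos in auto)
    then obtain x where x: "is_pos_zero (f n) k x" "z - d < x" "x \<le> z + d" by blast
    have "dist x z < e" using x d d' e unfolding dist_real_def by linarith
    then show ?case using x(1) by blast
  qed
qed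

text \<open>By induction: past a point \<open>a\<close> with \<open>k\<close> zeros up to it
  (\<open>0\<close>, or the \<open>k\<close>th zero), the zeros in \<open>(a, w]\<close> form a
  finite nonempty set, whose minimum is the next one.\<close>

lemma is_pos_zero_exists:
  assumes fin: "\<And>R. finite {y. 0 < y \<and> y \<le> R \<and> f y = 0}"
    and unb: "\<And>R. \<exists>y>R. f y = 0" and "k > 0"
  shows "\<exists>x. is_pos_zero f k x"
  using \<open>k > 0\<close>
proof (induction k)
  case (Suc k)
  obtain a where a: "a \<ge> 0" "card {y. 0 < y \<and> y \<le> a \<and> f y = 0} = k"
  proof (cases "k = 0")
    case True
    have "{y. 0 < y \<and> y \<le> (0::real) \<and> f y = 0} = {}" by auto
    then have "card {y. 0 < y \<and> y \<le> (0::real) \<and> f y = 0} = k" unfolding True by (simp only: card.empty)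
    then show ?thesis using that[of 0] by simp
  next
    case False
    then obtain x where "is_pos_zero f k x" using Suc.IH by auto
    then show ?thesis using that[of x] by (simp add: is_pos_zero_def)
  qed
  obtain w where w: "w > a" "f w = 0" using unb by blast
  let ?S = "{y. a < y \<and> y \<le> w \<and> f y = 0}"
  have finS: "finite ?S"
    by (rule finite_subset[OF _ fin[of w]]) (use a in auto)
  define b where "b = Min ?S"
  have bS: "b \<in> ?S" unfolding b_def using finS w by (intro Min_in) auto
  have "{y. 0 < y \<and> y \<le> b \<and> f y = 0} = insert b {y. 0 < y \<and> y \<le> a \<and> f y = 0}"
  proof (intro equalityI subsetI)
    fix y assume y: "y \<in> {y. 0 < y \<and> y \<le> b \<and> f y = 0}"
    have "y = b" if "y > a"
    proof -
      have "y \<in> ?S" using y bS that by auto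
      then have "b \<le> y" unfolding b_def using finS by (rule Min_le[rotated])
      then show ?thesis using y by auto
    qed
    then show "y \<in> insert b {y. 0 < y \<and> y \<le> a \<and> f y = 0}" using y by force
  qed (use bS a in auto)
  then have "card {y. 0 < y \<and> y \<le> b \<and> f y = 0} = Suc k"
    using a fin[of a] bS by simp
  then have "is_pos_zero f (Suc k) b"
    using bS a(1) fin[of b] by (simp add: is_pos_zero_def)
  then show ?case ..
qed simp

text \<open>Serves two changes of variable: \<open>2 * sqrt z\<close>, from the Clifford to the
  Bessel function, and \<open>y / s\<close>, undoing the rescaling.\<close>

lemma is_pos_zero_transfer:
  assumes mono: "strict_mono_on {0<..} \<phi>" and surj: "\<phi> ` {0<..} = {0<..}"
    and zeros: "\<And>y. y > 0 \<Longrightarrow> f (\<phi> y) = 0 \<longleftrightarrow> g y = 0"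
    and x: "is_pos_zero g k x"
  shows "is_pos_zero f k (\<phi> x)"
proof -
  have x0: "x > 0" "g x = 0" using x by (auto simp: is_pos_zero_def)
  have le: "\<phi> y \<le> \<phi> x \<longleftrightarrow> y \<le> x" if "y > 0" for y
    using strict_mono_on_less_eq[OF mono, of y x] that x0 by simp
  have pos: "\<phi> y > 0" if "y > 0" for y using surj that by blast
  have eq: "{y. 0 < y \<and> y \<le> \<phi> x \<and> f y = 0} = \<phi> ` {y. 0 < y \<and> y \<le> x \<and> g y = 0}"
  proof (intro equalityI subsetI)
    fix y assume y: "y \<in> {y. 0 < y \<and> y \<le> \<phi> x \<and> f y = 0}"
    then obtain w where "w > 0" "y = \<phi> w" using surj by (metis (mono_tags, lifting) imageE greaterThan_iff mem_Collect_eq)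
    then show "y \<in> \<phi> ` {y. 0 < y \<and> y \<le> x \<and> g y = 0}" using y le zeros by auto
  qed (use le zeros pos in auto)
  have "inj_on \<phi> {y. 0 < y \<and> y \<le> x \<and> g y = 0}"
    by (rule inj_on_subset[OF strict_mono_on_imp_inj_on[OF mono]]) auto
  then show ?thesis
    using x pos zeros[OF x0(1)] unfolding is_pos_zero_def eq by (auto simp: card_image)
qed

subsection \<open>Mehler-Heine asymptotics of Laguerre polynomials\<close>

text \<open>For positive \<open>s\<close>, the falling factorial
  \<open>s (s - 1) ... (s - m + 1)\<close> over \<open>s^m\<close>. As a product it vanishes by
  itself for \<open>m > s\<close>, so the finite Laguerre sum can be written as a full power
  series.\<close>

definition falling_ratio :: "nat \<Rightarrow> nat \<Rightarrow> real" where
  "falling_ratio s m = (\<Prod>i<m. 1 - real i / real s)"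

lemma falling_ratio_eq_0: "s > 0 \<Longrightarrow> s < m \<Longrightarrow> falling_ratio s m = 0"
  by (auto simp: falling_ratio_def intro!: bexI[of _ s])

lemma falling_ratio_altdef:
  assumes "s > 0" "m \<le> s"
  shows "falling_ratio s m = fact s / (fact (s - m) * real s ^ m)"
  using assms(2)
proof (induction m)
  case (Suc m)
  have "fact (s - m) = real (s - m) * fact (s - Suc m)"
    using Suc.prems by (metis Suc_diff_Suc Suc_le_lessD fact_Suc of_nat_fact of_nat_mult)
  moreover have "1 - real m / real s = real (s - m) / real s"
    using assms(1) Suc.prems by (simp add: field_simps of_nat_diff)
  moreover have "falling_ratio s (Suc m) = falling_ratio s m * (1 - real m / real s)"
    by (simp add: falling_ratio_def)
  ultimately show ?case
    using Suc assms(1) by simp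
qed (simp add: falling_ratio_def)

lemma falling_ratio_bounds: "0 \<le> falling_ratio s m" "falling_ratio s m \<le> 1"
proof -
  \<comment> \<open>For \<open>s = 0\<close> division by zero makes every factor 1. For
    \<open>s < m\<close> some factors may be negative, but the one with \<open>i = s\<close> is
    zero.\<close>
  consider "s = 0" | "s > 0" "m \<le> s" | "s > 0" "s < m" by linarith
  then have "0 \<le> falling_ratio s m \<and> falling_ratio s m \<le> 1"
  proof cases
    case 2
    then show ?thesis
      unfolding falling_ratio_def by (intro conjI prod_nonneg prod_le_1) (auto simp: field_simps)
  qed (simp_all add: falling_ratio_eq_0, simp add: falling_ratio_def)
  then show "0 \<le> falling_ratio s m" "falling_ratio s m \<le> 1" by auto
qed

lemma falling_ratio_tendsto_1: "(\<lambda>s. falling_ratio s m) \<longlonglongrightarrow> 1"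
proof -
  have "(\<lambda>s. \<Prod>i<m. 1 - real i / real s) \<longlonglongrightarrow> (\<Prod>i<m. 1 - 0)"
    by (intro tendsto_intros lim_const_over_n)
  then show ?thesis by (simp add: falling_ratio_def)
qed

text \<open>For large \<open>s\<close>, up to the factor
  \<open>(-1)^j Gamma (s + \<alpha> + 1) / s!\<close>, this is the \<open>j\<close>th derivative of
  the Laguerre polynomial in the variable \<open>z = s x\<close>. Differentiating \<open>j\<close>
  times shifts the coefficient index, hence the argument \<open>m + j\<close>.\<close>

definition laguerre_clifford :: "real \<Rightarrow> nat \<Rightarrow> nat \<Rightarrow> real \<Rightarrow> real" where
  "laguerre_clifford \<alpha> j s z =
     (\<Sum>m. clifford_coeff (\<alpha> + real j) m * falling_ratio s (m + j) * z ^ m)"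

lemma summable_laguerre_clifford:
  "summable (\<lambda>m. clifford_coeff \<nu> m * falling_ratio s (m + j) * z ^ m)"
proof (rule summable_comparison_test'[OF summable_norm_clifford_coeff[of \<nu> z]])
  fix m :: nat
  show "norm (clifford_coeff \<nu> m * falling_ratio s (m + j) * z ^ m) \<le> norm (clifford_coeff \<nu> m * z ^ m)"
    using mult_right_mono[OF falling_ratio_bounds(2)[of s "m + j"], of "\<bar>clifford_coeff \<nu> m * z ^ m\<bar>"]
      falling_ratio_bounds(1)[of s "m + j"] by (simp add: abs_mult mult_ac)
qed

lemma DERIV_laguerre_clifford:
  "(laguerre_clifford \<alpha> j s has_real_derivative - laguerre_clifford \<alpha> (Suc j) s z) (at z)"
proof -
  let ?c = "\<lambda>m. clifford_coeff (\<alpha> + real j) m * falling_ratio s (m + j)"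
  have "((\<lambda>z. \<Sum>m. ?c m * z ^ m) has_real_derivative (\<Sum>m. diffs ?c m * z ^ m)) (at z)"
    by (rule termdiffs_strong_converges_everywhere[OF summable_laguerre_clifford])
  moreover have "diffs ?c m = - (clifford_coeff (\<alpha> + real (Suc j)) m * falling_ratio s (m + Suc j))" for m
  proof -
    have "diffs ?c m = diffs (clifford_coeff (\<alpha> + real j)) m * falling_ratio s (m + Suc j)"
      by (simp add: diffs_def)
    then show ?thesis by (simp add: diffs_clifford_coeff add_ac)
  qed
  ultimately show ?thesis
    using suminf_minus[OF summable_laguerre_clifford[of "\<alpha> + real (Suc j)" s "Suc j" z]]
    by (simp add: laguerre_clifford_def[abs_def])
qed

text \<open>On \<open>[0, R]\<close> every term of the difference is bounded by its size at
  \<open>z = R\<close>, independently of \<open>z\<close>. The sum of these bounds tends to 0 by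
  Tannery's theorem, dominated by the absolutely convergent limit series at
  \<open>R\<close>.\<close>

lemma uniform_limit_laguerre_clifford:
  "uniform_limit {0..R} (laguerre_clifford \<alpha> j) (bessel_clifford (\<alpha> + real j)) sequentially"
proof (rule uniform_limitI)
  fix e :: real assume e: "e > 0"
  let ?c = "clifford_coeff (\<alpha> + real j)"
  let ?a = "\<lambda>m s. norm (?c m * R ^ m) * (1 - falling_ratio s (m + j))"
  have bnd: "norm (?a m s) \<le> norm (?c m * R ^ m)" for m s
    using mult_left_mono[of "1 - falling_ratio s (m + j)" 1 "norm (?c m * R ^ m)"]
      falling_ratio_bounds[of s "m + j"] by (simp add: abs_mult)
  have sum: "summable (\<lambda>m. ?a m s)" for s
    by (rule summable_comparison_test'[OF summable_norm_clifford_coeff[of "\<alpha> + real j" R] bnd])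
  have "((\<lambda>s. ?a m s) \<longlonglongrightarrow> norm (?c m * R ^ m) * (1 - 1))" for m
    by (intro tendsto_intros falling_ratio_tendsto_1)
  then have "eventually (\<lambda>s. summable (\<lambda>m. norm (?a m s))) sequentially \<and>
      summable (\<lambda>m. norm (0 :: real)) \<and> (\<lambda>s. \<Sum>m. ?a m s) \<longlonglongrightarrow> (\<Sum>m. 0)"
    by (intro tannerys_theorem[where M = "\<lambda>m. norm (?c m * R ^ m)"] summable_norm_clifford_coeff
          always_eventually allI)
       (use bnd in auto)
  then have "(\<lambda>s. \<Sum>m. ?a m s) \<longlonglongrightarrow> 0" by simp
  then have "eventually (\<lambda>s. (\<Sum>m. ?a m s) < e) sequentially"
    using e by (rule order_tendstoD)
  then show "eventually (\<lambda>s. \<forall>z\<in>{0..R}. dist (laguerre_clifford \<alpha> j s z)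
      (bessel_clifford (\<alpha> + real j) z) < e) sequentially"
  proof eventually_elim
    case (elim s)
    show ?case
    proof
      fix z assume z: "z \<in> {0..R}"
      let ?d = "\<lambda>m. ?c m * falling_ratio s (m + j) * z ^ m - ?c m * z ^ m"
      have le: "norm (?d m) \<le> ?a m s" for m
      proof -
        have "?d m = - (?c m * z ^ m * (1 - falling_ratio s (m + j)))"
          by (simp add: algebra_simps)
        then have "norm (?d m) = norm (?c m) * z ^ m * (1 - falling_ratio s (m + j))"
          using z falling_ratio_bounds[of s "m + j"] by (simp add: abs_mult)
        also have "\<dots> \<le> norm (?c m) * R ^ m * (1 - falling_ratio s (m + j))"
          using z falling_ratio_bounds[of s "m + j"]
          by (intro mult_right_mono mult_left_mono power_mono) auto
        finally show ?thesis using z by (simp add: abs_mult)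
      qed
      have sn: "summable (\<lambda>m. norm (?d m))"
        by (rule summable_comparison_test'[OF sum[of s]]) (use le in simp)
      have "dist (laguerre_clifford \<alpha> j s z) (bessel_clifford (\<alpha> + real j) z) = norm (\<Sum>m. ?d m)"
        unfolding laguerre_clifford_def bessel_clifford_def dist_norm
        by (subst suminf_diff[OF summable_laguerre_clifford summable_clifford_coeff]) simp
      also have "\<dots> \<le> (\<Sum>m. norm (?d m))"
        by (rule summable_norm[OF sn])
      also have "\<dots> \<le> (\<Sum>m. ?a m s)"
        by (rule suminf_le[OF le sn sum])
      finally show "dist (laguerre_clifford \<alpha> j s z) (bessel_clifford (\<alpha> + real j) z) < e"
        using elim by linarith
    qed
  qed
qed

text \<open>The binomial coefficient is a Pochhammer symbol, that is
  \<open>Gamma (s + \<alpha> + 1) * rGamma (k + \<alpha> + 1)\<close> over \<open>(s - k)!\<close>.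
  Only the first factor must avoid poles, which \<open>pos\<close> ensures; the second may vanish
  when \<alpha> is a negative integer.\<close>

lemma poly_laguerre_eq_clifford:
  assumes s: "s > 0" and pos: "real s + \<alpha> + 1 > 0"
  shows "poly (laguerre \<alpha> s) x =
    Gamma (real s + \<alpha> + 1) / fact s * laguerre_clifford \<alpha> 0 s (real s * x)"
proof -
  have term_eq: "((real s + \<alpha>) gchoose (s - k)) * (- x) ^ k / fact k =
      Gamma (real s + \<alpha> + 1) / fact s * (clifford_coeff \<alpha> k * falling_ratio s k * (real s * x) ^ k)"
    if k: "k \<le> s" for k
  proof -
    have a: "real s + \<alpha> - real (s - k) + 1 = real k + \<alpha> + 1"
      "real k + \<alpha> + 1 + real (s - k) = real s + \<alpha> + 1"
      using k by (simp_all add: of_nat_diff)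
    have "rGamma (real k + \<alpha> + 1) = pochhammer (real k + \<alpha> + 1) (s - k) * rGamma (real s + \<alpha> + 1)"
      using pochhammer_rGamma[of "real k + \<alpha> + 1" "s - k"] by (simp only: a)
    moreover have "rGamma (real s + \<alpha> + 1) * Gamma (real s + \<alpha> + 1) = 1"
      using Gamma_real_pos[OF pos] by (simp add: rGamma_inverse_Gamma)
    ultimately have "Gamma (real s + \<alpha> + 1) * rGamma (real k + \<alpha> + 1) = pochhammer (real k + \<alpha> + 1) (s - k)"
      by (simp add: mult_ac)
    then have g: "(real s + \<alpha>) gchoose (s - k) =
        Gamma (real s + \<alpha> + 1) * rGamma (real k + \<alpha> + 1) / fact (s - k)"
      by (simp only: gbinomial_pochhammer' a)
    show ?thesis
      unfolding g clifford_coeff_def falling_ratio_altdef[OF s k] power_mult_distrib power_minus[of x]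
      using s by (simp add: field_simps)
  qed
  have "laguerre_clifford \<alpha> 0 s (real s * x) =
      (\<Sum>k\<le>s. clifford_coeff \<alpha> k * falling_ratio s k * (real s * x) ^ k)"
    unfolding laguerre_clifford_def
    by (subst suminf_finite[of "{..s}"]) (auto simp: falling_ratio_eq_0[OF s])
  then show ?thesis
    by (simp add: poly_laguerre term_eq sum_distrib_left)
qed

lemma higher_deriv_laguerre:
  assumes "s > 0" and "real s + \<alpha> + 1 > 0"
  shows "(deriv ^^ j) (poly (laguerre \<alpha> s)) x =
    Gamma (real s + \<alpha> + 1) / fact s * (real s ^ j * ((-1) ^ j * laguerre_clifford \<alpha> j s (real s * x)))"
proof (induction j arbitrary: x)
  case 0
  show ?case using poly_laguerre_eq_clifford[OF assms] by simp
next
  case (Suc j)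
  let ?C = "Gamma (real s + \<alpha> + 1) / fact s"
  have "((\<lambda>x. laguerre_clifford \<alpha> j s (real s * x)) has_real_derivative
      - laguerre_clifford \<alpha> (Suc j) s (real s * x) * real s) (at x)"
    by (rule DERIV_chain2[OF DERIV_laguerre_clifford]) (auto intro!: derivative_eq_intros)
  then have "((\<lambda>x. ?C * (real s ^ j * ((-1) ^ j * laguerre_clifford \<alpha> j s (real s * x)))) has_real_derivative
      ?C * (real s ^ j * ((-1) ^ j * (- laguerre_clifford \<alpha> (Suc j) s (real s * x) * real s)))) (at x)"
    by (intro DERIV_cmult)
  moreover have "(deriv ^^ j) (poly (laguerre \<alpha> s)) =
      (\<lambda>x. ?C * (real s ^ j * ((-1) ^ j * laguerre_clifford \<alpha> j s (real s * x))))"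
    using Suc by (intro ext)
  ultimately show ?case
    by (simp add: DERIV_imp_deriv)
qed

subsection \<open>Wronskians and their rescaled limits\<close>

text \<open>The class C1 is closed under sums and products, hence passes to determinants by the
  Leibniz formula, and it supplies the continuity of \<open>A'\<close> at \<open>0\<close> needed
  for the limit of the derivatives.\<close>

lemma C1_differentiable_on_UNIV_iff:
  fixes f :: "real \<Rightarrow> real"
  shows "f C1_differentiable_on UNIV \<longleftrightarrow>
    (\<exists>f'. (\<forall>x. (f has_real_derivative f' x) (at x)) \<and> continuous_on UNIV f')"
  by (simp add: C1_differentiable_on_def has_real_derivative_iff_has_vector_derivative)

lemma C1_differentiable_on_sum:
  fixes f :: "'a \<Rightarrow> real \<Rightarrow> real"
  assumes "\<And>i. i \<in> I \<Longrightarrow> f i C1_differentiable_on S"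
  shows "(\<lambda>x. \<Sum>i\<in>I. f i x) C1_differentiable_on S"
  using assms by (induction I rule: infinite_finite_induct) simp_all

lemma C1_differentiable_on_prod:
  fixes f :: "'a \<Rightarrow> real \<Rightarrow> real"
  assumes "\<And>i. i \<in> I \<Longrightarrow> f i C1_differentiable_on S"
  shows "(\<lambda>x. \<Prod>i\<in>I. f i x) C1_differentiable_on S"
  using assms by (induction I rule: infinite_finite_induct) simp_all

lemma C1_differentiable_on_det:
  fixes a :: "nat \<Rightarrow> nat \<Rightarrow> real \<Rightarrow> real"
  assumes "\<And>i j. i < n \<Longrightarrow> j < n \<Longrightarrow> a i j C1_differentiable_on S"
  shows "(\<lambda>x. Determinant.det (Matrix.mat n n (\<lambda>(i, j). a i j x))) C1_differentiable_on S"
proof -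
  have less: "p i < n" if "p permutes {0..<n}" "i < n" for p i
    using permutes_in_image[OF that(1), of i] that(2) by simp
  have "Determinant.det (Matrix.mat n n (\<lambda>(i, j). a i j x)) =
      (\<Sum>p | p permutes {0..<n}. signof p * (\<Prod>i = 0..<n. a i (p i) x))" for x
    by (subst det_def'[of _ n])
       (auto intro!: sum.cong prod.cong simp: less)
  then show ?thesis
    by (simp only:) (intro C1_differentiable_on_sum C1_differentiable_on_mult
        C1_differentiable_on_const C1_differentiable_on_prod assms; simp add: less)
qed

text \<open>The cofactor at column \<open>j\<close> of the row appended below \<open>fs\<close>,
  which has index \<open>length fs\<close> when counted from 0. The conditional skips the derivative
  of order \<open>j\<close>.\<close>

definition Wr_cofactor :: "(real \<Rightarrow> real) list \<Rightarrow> nat \<Rightarrow> real \<Rightarrow> real" where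
  "Wr_cofactor fs j x = (-1) ^ (length fs + j) * Determinant.det
     (Matrix.mat (length fs) (length fs)
       (\<lambda>(i, l). (deriv ^^ (if l < j then l else Suc l)) (fs ! i) x))"

lemma Wr_append_single:
  "Wr (fs @ [g]) x = (\<Sum>j\<le>length fs. Wr_cofactor fs j x * (deriv ^^ j) g x)"
proof -
  let ?r = "length fs"
  let ?M = "Matrix.mat (Suc ?r) (Suc ?r) (\<lambda>(i, j). (deriv ^^ j) ((fs @ [g]) ! i) x)"
  have "Wr (fs @ [g]) x = (\<Sum>j<Suc ?r. ?M $$ (?r, j) * cofactor ?M ?r j)"
    unfolding Wr_def length_append_singleton by (rule laplace_expansion_row) auto
  also have "\<dots> = (\<Sum>j\<le>?r. Wr_cofactor fs j x * (deriv ^^ j) g x)"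
    unfolding lessThan_Suc_atMost
  proof (rule sum.cong[OF refl])
    fix j assume j: "j \<in> {..?r}"
    have "mat_delete ?M ?r j = Matrix.mat ?r ?r
       (\<lambda>(i, l). (deriv ^^ (if l < j then l else Suc l)) (fs ! i) x)"
      by (rule eq_matI) (auto simp: mat_delete_def nth_append)
    then show "?M $$ (?r, j) * cofactor ?M ?r j = Wr_cofactor fs j x * (deriv ^^ j) g x"
      using j by (simp add: cofactor_def Wr_cofactor_def)
  qed
  finally show ?thesis .
qed

lemma Wr_cofactor_length: "Wr_cofactor fs (length fs) x = Wr fs x"
proof -
  have "Matrix.mat (length fs) (length fs)
      (\<lambda>(i, l). (deriv ^^ (if l < length fs then l else Suc l)) (fs ! i) x) =
    Matrix.mat (length fs) (length fs) (\<lambda>(i, l). (deriv ^^ l) (fs ! i) x)"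
    by (rule eq_matI) auto
  then show ?thesis by (simp add: Wr_cofactor_def Wr_def flip: mult_2)
qed

section \<open>Regularity of the seed functions and their cofactors\<close>

lemma higher_deriv_poly: "(deriv ^^ k) (poly p) = poly ((pderiv ^^ k) p)" for p :: "real poly"
proof (induction k)
  case (Suc k)
  have "deriv (poly q) = poly (pderiv q)" for q :: "real poly"
    by (intro ext DERIV_imp_deriv poly_DERIV)
  with Suc show ?case by simp
qed simp

lemma higher_deriv_exp_poly:
  "\<exists>q. (deriv ^^ k) (\<lambda>x. exp x * poly p x) = (\<lambda>x. exp x * poly q x)" for p :: "real poly"
proof (induction k)
  case (Suc k)
  then obtain q where q: "(deriv ^^ k) (\<lambda>x. exp x * poly p x) = (\<lambda>x. exp x * poly q x)" ..
  have "deriv (\<lambda>x. exp x * poly q x) x = exp x * poly (q + pderiv q) x" for x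
    by (rule DERIV_imp_deriv) (auto intro!: derivative_eq_intros poly_DERIV simp: algebra_simps)
  then have "(deriv ^^ Suc k) (\<lambda>x. exp x * poly p x) = (\<lambda>x. exp x * poly (q + pderiv q) x)"
    unfolding funpow.simps o_apply q by (rule ext)
  then show ?case by blast
qed auto

lemma C1_differentiable_on_poly: "poly p C1_differentiable_on UNIV" for p :: "real poly"
  unfolding C1_differentiable_on_UNIV_iff
  by (intro exI[of _ "poly (pderiv p)"] conjI allI poly_DERIV continuous_intros)

lemma C1_differentiable_on_exp: "(\<lambda>x. exp (c * x)) C1_differentiable_on UNIV" for c :: real
  unfolding C1_differentiable_on_UNIV_iff
  by (intro exI[of _ "\<lambda>x. c * exp (c * x)"]) (auto intro!: derivative_eq_intros continuous_intros)

text \<open>Polynomials, and \<open>exp\<close> times polynomials, are each closed under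
  differentiation; the reflected argument is absorbed into the polynomial by composition with
  \<open>-x\<close>.\<close>

lemma C1_differentiable_on_seed_functions:
  assumes "f \<in> set (seed_functions \<alpha> lam mu)"
  shows "(deriv ^^ k) f C1_differentiable_on UNIV"
proof -
  consider p where "f = poly p" | p where "f = (\<lambda>x. exp x * poly p (- x))"
    using assms by (auto simp: seed_functions_def)
  then show ?thesis
  proof cases
    case 1
    then show ?thesis by (simp add: higher_deriv_poly C1_differentiable_on_poly)
  next
    case 2
    then have "f = (\<lambda>x. exp x * poly (pcompose p [:0, -1:]) x)"
      by (simp add: poly_pcompose)
    then obtain q where "(deriv ^^ k) f = (\<lambda>x. exp x * poly q x)"
      using higher_deriv_exp_poly by blast
    then show ?thesis
      using C1_differentiable_on_mult[OF C1_differentiable_on_exp[of 1] C1_differentiable_on_poly[of q]]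
      by simp
  qed
qed

lemma C1_differentiable_on_Wr_cofactor:
  assumes "\<And>f k. f \<in> set fs \<Longrightarrow> (deriv ^^ k) f C1_differentiable_on S"
  shows "Wr_cofactor fs j C1_differentiable_on S"
  unfolding Wr_cofactor_def[abs_def]
  by (intro C1_differentiable_on_mult C1_differentiable_on_const C1_differentiable_on_det assms) simp

section \<open>Uniform limits under rescaling\<close>

lemma uniform_limit_sum:
  fixes f :: "'a \<Rightarrow> 'b \<Rightarrow> 'c \<Rightarrow> 'd :: real_normed_vector"
  assumes "\<And>i. i \<in> I \<Longrightarrow> uniform_limit X (f i) (l i) net"
  shows "uniform_limit X (\<lambda>n x. \<Sum>i\<in>I. f i n x) (\<lambda>x. \<Sum>i\<in>I. l i x) net"
  using assms
  by (induction I rule: infinite_finite_induct) (auto intro: uniform_limit_add uniform_limit_const)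

lemma uniform_limit_pointwise_const:
  assumes "(u \<longlongrightarrow> l) net"
  shows "uniform_limit X (\<lambda>n x. u n) (\<lambda>x. l) net"
  by (rule uniform_limitI) (auto elim!: eventually_mono dest: tendstoD[OF assms])

lemma uniform_limit_rescale:
  fixes A :: "real \<Rightarrow> real"
  assumes "isCont A 0"
  shows "uniform_limit {0..R} (\<lambda>s z. A (z / real s)) (\<lambda>z. A 0) sequentially"
proof (rule uniform_limitI)
  fix e :: real assume "e > 0"
  then obtain d where d: "d > 0" "\<And>x. dist x 0 < d \<Longrightarrow> dist (A x) (A 0) < e"
    using assms unfolding continuous_at_eps_delta by blast
  have "(\<lambda>s. R / real s) \<longlonglongrightarrow> 0" by (rule lim_const_over_n)
  then have "eventually (\<lambda>s. R / real s < d) sequentially"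
    using d(1) by (rule order_tendstoD)
  then show "eventually (\<lambda>s. \<forall>z\<in>{0..R}. dist (A (z / real s)) (A 0) < e) sequentially"
  proof eventually_elim
    case (elim s)
    show ?case
    proof
      fix z assume z: "z \<in> {0..R}"
      have "\<bar>z / real s\<bar> \<le> R / real s" using z by (simp add: divide_right_mono)
      then show "dist (A (z / real s)) (A 0) < e" using elim by (intro d(2)) simp
    qed
  qed
qed

lemma uniform_limit_mult_compact:
  fixes f g :: "'a \<Rightarrow> real \<Rightarrow> real"
  assumes "compact S" "uniform_limit S f l net" "uniform_limit S g m net"
    and "continuous_on S l" "continuous_on S m"
  shows "uniform_limit S (\<lambda>n x. f n x * g n x) (\<lambda>x. l x * m x) net"
  using assms by (intro uniform_lim_mult compact_imp_bounded compact_continuous_image)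

text \<open>\<open>f\<close> is the expanded Wronskian divided by its Gamma factor and by
  \<open>s^r\<close>, which turns \<open>s^j\<close> into \<open>(1 / s) ^ (r - j)\<close>. In
  \<open>f'\<close> the chain rule puts a further \<open>1 / s\<close> on the terms with
  \<open>A'\<close>, so these vanish in the limit even for \<open>j = r\<close>.\<close>

lemma uniform_limit_laguerre_combination:
  fixes A A' :: "nat \<Rightarrow> real \<Rightarrow> real" and \<alpha> :: real and r :: nat
  assumes dA: "\<And>j x. (A j has_real_derivative A' j x) (at x)"
    and cA': "\<And>j. continuous_on UNIV (A' j)"
  defines "f \<equiv> \<lambda>s z. \<Sum>j\<le>r. (1 / real s) ^ (r - j) *
             ((-1) ^ j * (A j (z / real s) * laguerre_clifford \<alpha> j s z))"
    and "f' \<equiv> \<lambda>s z. \<Sum>j\<le>r. (1 / real s) ^ (r - j) *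
             ((-1) ^ j * (1 / real s * (A' j (z / real s) * laguerre_clifford \<alpha> j s z) -
                A j (z / real s) * laguerre_clifford \<alpha> (Suc j) s z))"
  shows "(f s has_real_derivative f' s z) (at z)"
    and "uniform_limit {0..R} f (\<lambda>z. (-1) ^ r * A r 0 * bessel_clifford (\<alpha> + real r) z) sequentially"
    and "uniform_limit {0..R} f'
           (\<lambda>z. (-1) ^ r * A r 0 * - bessel_clifford (\<alpha> + real r + 1) z) sequentially"
proof -
  have "((\<lambda>z. A j (z / real s) * laguerre_clifford \<alpha> j s z) has_real_derivative
      1 / real s * (A' j (z / real s) * laguerre_clifford \<alpha> j s z) -
                A j (z / real s) * laguerre_clifford \<alpha> (Suc j) s z) (at z)" for j
  proof -
    have "((\<lambda>z. A j (z / real s)) has_real_derivative A' j (z / real s) * (1 / real s)) (at z)"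
      by (rule DERIV_chain2[OF dA DERIV_cdivide[OF DERIV_ident]])
    from DERIV_mult[OF this DERIV_laguerre_clifford] show ?thesis
      by (rule DERIV_cong) (simp add: algebra_simps)
  qed
  then show "(f s has_real_derivative f' s z) (at z)"
    unfolding f_def f'_def by (intro DERIV_sum DERIV_cmult)
next
  let ?G = "\<lambda>j. bessel_clifford (\<alpha> + real j)"
  note cont = continuous_on_const continuous_on_mult continuous_on_diff continuous_on_bessel_clifford
  have LA: "uniform_limit {0..R} (\<lambda>s z. B (z / real s) * laguerre_clifford \<alpha> j s z)
      (\<lambda>z. B 0 * ?G j z) sequentially" if "isCont B 0" for B :: "real \<Rightarrow> real" and j
    by (intro uniform_limit_mult_compact compact_Icc uniform_limit_rescale that
          uniform_limit_laguerre_clifford cont)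
  have iA: "isCont (A j) 0" for j using dA by (rule DERIV_isCont)
  have iA': "isCont (A' j) 0" for j using cA' by (simp add: continuous_on_eq_continuous_at)
  have inv: "(\<lambda>s. 1 / real s) \<longlonglongrightarrow> 0" by (rule lim_const_over_n)
  have pw: "(\<lambda>s. (1 / real s) ^ m) \<longlonglongrightarrow> 0 ^ m" for m
    by (intro tendsto_power inv)
  \<comment> \<open>The limit weights are \<open>0 ^ (r - j)\<close>; as \<open>0 ^ 0 = 1\<close>,
    only \<open>j = r\<close> is kept.\<close>
  have last: "(\<Sum>j\<le>r. 0 ^ (r - j) * h j) = h r" for h :: "nat \<Rightarrow> real"
  proof -
    have "(\<Sum>j\<le>r. 0 ^ (r - j) * h j) = (\<Sum>j\<in>{r}. 0 ^ (r - j) * h j)"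
      by (rule sum.mono_neutral_right) auto
    then show ?thesis by simp
  qed
  have "uniform_limit {0..R} f
      (\<lambda>z. \<Sum>j\<le>r. 0 ^ (r - j) * ((-1) ^ j * (A j 0 * ?G j z))) sequentially"
    unfolding f_def
    by (intro uniform_limit_sum LA iA uniform_limit_mult_compact compact_Icc
          uniform_limit_pointwise_const[OF pw] uniform_limit_const cont)
  then show "uniform_limit {0..R} f (\<lambda>z. (-1) ^ r * A r 0 * ?G r z) sequentially"
    by (simp add: last mult.assoc)
  have "uniform_limit {0..R} f'
      (\<lambda>z. \<Sum>j\<le>r. 0 ^ (r - j) * ((-1) ^ j * (0 * (A' j 0 * ?G j z) - A j 0 * ?G (Suc j) z))) sequentially"
    unfolding f'_def
    by (intro uniform_limit_sum uniform_limit_minus LA iA iA' uniform_limit_mult_compact compact_Icc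
          uniform_limit_pointwise_const[OF pw] uniform_limit_pointwise_const[OF inv]
          uniform_limit_const cont)
  then show "uniform_limit {0..R} f'
           (\<lambda>z. (-1) ^ r * A r 0 * - bessel_clifford (\<alpha> + real r + 1) z) sequentially"
    unfolding last by (simp add: mult.assoc add_ac)
qed

subsection \<open>Zeros of exceptional Laguerre polynomials\<close>

lemma exceptional_laguerre_expansion:
  "exceptional_laguerre \<alpha> lam mu n x =
    (\<Sum>j\<le>length lam + length mu.
       exp (- real (length mu) * x) * Wr_cofactor (seed_functions \<alpha> lam mu) j x *
       (deriv ^^ j) (poly (laguerre \<alpha> (n + length lam - (sum_list lam + sum_list mu)))) x)"
proof -
  have "length (seed_functions \<alpha> lam mu) = length lam + length mu"
    by (simp add: seed_functions_def shifted_parts_def)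
  then show ?thesis
    by (simp add: exceptional_laguerre_def Wr_append_single sum_distrib_left mult.assoc)
qed

lemma is_pos_zero_bessel_J:
  assumes "is_pos_zero (bessel_clifford \<nu>) k z"
  shows "is_pos_zero (bessel_J \<nu>) k (2 * sqrt z)"
proof (rule is_pos_zero_transfer[OF _ _ _ assms])
  show "strict_mono_on {0<..} (\<lambda>z. 2 * sqrt z)"
    by (rule strict_mono_onI) simp
  show "(\<lambda>z. 2 * sqrt z) ` {0<..} = {0<..}"
  proof (intro equalityI subsetI)
    fix y :: real assume "y \<in> {0<..}"
    then show "y \<in> (\<lambda>z. 2 * sqrt z) ` {0<..}"
      by (intro image_eqI[of _ _ "(y / 2)\<^sup>2"]) auto
  qed auto
  show "bessel_J \<nu> (2 * sqrt y) = 0 \<longleftrightarrow> bessel_clifford \<nu> y = 0" if "y > 0" for y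
    using that by (simp add: bessel_J_eq_clifford power_mult_distrib)
qed

lemma bessel_clifford_kth_zero_exists:
  assumes "\<nu> > -1" "k > 0"
  shows "\<exists>z. is_pos_zero (bessel_clifford \<nu>) k z"
proof (rule is_pos_zero_exists[OF _ bessel_clifford_zero_beyond assms(2)])
  fix R
  have "- bessel_clifford (\<nu> + 1) x \<noteq> 0" if "x \<in> {0..R}" "bessel_clifford \<nu> x = 0" for x
    using that bessel_clifford_0_neq_0[OF assms(1)] bessel_clifford_zero_simple[OF assms(1), of x]
    by (cases "x = 0") auto
  from finite_simple_zeros[OF DERIV_bessel_clifford this]
  have "finite {x \<in> {0..R}. bessel_clifford \<nu> x = 0}" .
  then show "finite {y. 0 < y \<and> y \<le> R \<and> bessel_clifford \<nu> y = 0}"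
    by (rule finite_subset[rotated]) auto
qed

theorem corollary6p4:
  fixes \<alpha> :: real and lam mu :: "nat list" and k :: nat
  assumes "is_partition lam" and "is_partition mu"
    and "\<alpha> + real (length lam + length mu) > -1"
    and "generalized_laguerre \<alpha> lam mu 0 \<noteq> 0"
    and "k > 0"
  shows "(\<forall>\<^sub>F n in inf sequentially (principal (degree_sequence lam mu)).
            \<exists>x. is_pos_zero (exceptional_laguerre \<alpha> lam mu n) k x) \<and>
         ((\<lambda>n. sqrt (4 * real n * pos_zero (exceptional_laguerre \<alpha> lam mu n) k))
            \<longlongrightarrow> pos_zero (bessel_J (\<alpha> + real (length lam + length mu))) k)
           (inf sequentially (principal (degree_sequence lam mu)))"
proof -
  define r where "r = length lam + length mu"
  define \<nu> where "\<nu> = \<alpha> + real r"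
  define fs where "fs = seed_functions \<alpha> lam mu"
  have len: "length fs = r"
    by (simp add: fs_def r_def seed_functions_def shifted_parts_def)
  have \<nu>: "\<nu> > -1" using assms(3) by (simp add: \<nu>_def r_def)
  define A where "A j x = exp (- real (length mu) * x) * Wr_cofactor fs j x" for j x
  have "A j C1_differentiable_on UNIV" for j
    unfolding A_def fs_def
    by (intro C1_differentiable_on_mult C1_differentiable_on_exp C1_differentiable_on_Wr_cofactor
          C1_differentiable_on_seed_functions)
  then have "\<forall>j. \<exists>A'. (\<forall>x. (A j has_real_derivative A' x) (at x)) \<and> continuous_on UNIV A'"
    by (simp add: C1_differentiable_on_UNIV_iff)
  from choice[OF this] obtain A' where A': "\<And>j x. (A j has_real_derivative A' j x) (at x)"
      "\<And>j. continuous_on UNIV (A' j)"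
    by blast
  have Ar: "A r 0 \<noteq> 0"
    using assms(4) unfolding A_def len[symmetric] Wr_cofactor_length
    by (simp add: generalized_laguerre_def fs_def)
  define f where "f s z = (\<Sum>j\<le>r. (1 / real s) ^ (r - j) *
             ((-1) ^ j * (A j (z / real s) * laguerre_clifford \<alpha> j s z)))" for s z
  define F where "F = (\<lambda>z. (-1) ^ r * A r 0 * bessel_clifford \<nu> z)"
  note conv = uniform_limit_laguerre_combination[where A = A and A' = A' and r = r and \<alpha> = \<alpha>,
      OF A', folded f_def \<nu>_def, folded F_def]
  obtain z where z: "is_pos_zero (bessel_clifford \<nu>) k z"
    using bessel_clifford_kth_zero_exists[OF \<nu> assms(5)] ..
  have zF: "is_pos_zero F k z"
    using z Ar by (simp add: is_pos_zero_def F_def)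
  have near: "eventually (\<lambda>s. \<exists>x. is_pos_zero (f s) k x \<and> dist x z < e) sequentially"
    if e: "e > 0" for e
  proof (rule eventually_is_pos_zero_near[OF conv(1) _ _ conv(2,3) _ _ zF e])
    show "(F has_real_derivative (-1) ^ r * A r 0 * - bessel_clifford (\<nu> + 1) x) (at x)" for x
      unfolding F_def by (intro DERIV_cmult DERIV_bessel_clifford)
    show "continuous_on {0..R} (\<lambda>x. (-1) ^ r * A r 0 * - bessel_clifford (\<nu> + 1) x)" for R
      by (intro continuous_intros continuous_on_bessel_clifford)
    show "(-1) ^ r * A r 0 * - bessel_clifford (\<nu> + 1) x \<noteq> 0" if "x > 0" "F x = 0" for x
      using bessel_clifford_zero_simple[OF \<nu> that(1)] that(2) Ar by (simp add: F_def)
    show "F 0 \<noteq> 0"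
      using Ar bessel_clifford_0_neq_0[OF \<nu>] by (simp add: F_def)
  qed
  \<comment> \<open>\<open>S n\<close> is the Laguerre index. Its subtraction can truncate only for
    small \<open>n\<close>, and then \<open>S n = n + c\<close> with \<open>c\<close> constant, so
    \<open>n\<close> and \<open>S n\<close> are asymptotically equal.\<close>
  define c where "c = real (length lam) - real (sum_list lam + sum_list mu)"
  define S where "S n = n + length lam - (sum_list lam + sum_list mu)" for n
  have real_S: "eventually (\<lambda>n. real (S n) = real n + c) sequentially"
    using eventually_ge_at_top[of "sum_list lam + sum_list mu"]
    by eventually_elim (simp add: S_def c_def of_nat_diff)
  have S_top: "filterlim S sequentially sequentially"
    unfolding S_def filterlim_at_top
  proof
    fix N
    show "eventually (\<lambda>n. N \<le> n + length lam - (sum_list lam + sum_list mu)) sequentially"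
      using eventually_ge_at_top[of "N + sum_list lam + sum_list mu"] by eventually_elim simp
  qed
  have zeros: "eventually (\<lambda>s. \<forall>n x. S n = s \<longrightarrow> is_pos_zero (f s) k x \<longrightarrow>
      is_pos_zero (exceptional_laguerre \<alpha> lam mu n) k (x / real s)) sequentially"
    \<comment> \<open>This bound makes both \<open>s\<close> and \<open>s + \<alpha> + 1\<close>
      positive, so the factor pulled out of the Wronskian is nonzero.\<close>
    using eventually_gt_at_top[of "nat \<lceil>\<bar>\<alpha>\<bar>\<rceil>"]
  proof eventually_elim
    case (elim s)
    then have s: "s > 0" "real s + \<alpha> + 1 > 0" by linarith+
    show ?case
    proof (intro allI impI)
      fix n x assume n: "S n = s" and x: "is_pos_zero (f s) k x"
      let ?C = "Gamma (real s + \<alpha> + 1) / fact s"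
      have "exceptional_laguerre \<alpha> lam mu n (y / real s) = ?C * real s ^ r * f s y" for y
      proof -
        have pw: "real s ^ r * (1 / real s) ^ (r - j) = real s ^ j" if "j \<le> r" for j
        proof -
          have "real s ^ r = real s ^ j * real s ^ (r - j)" using that by (simp flip: power_add)
          then show ?thesis using s(1) by (simp add: power_one_over)
        qed
        have "?C * real s ^ r * f s y =
            (\<Sum>j\<le>r. ?C * ((real s ^ r * (1 / real s) ^ (r - j)) *
               ((-1) ^ j * (A j (y / real s) * laguerre_clifford \<alpha> j s y))))"
          by (simp add: f_def sum_distrib_left mult_ac)
        also have "\<dots> = (\<Sum>j\<le>r. A j (y / real s) * (deriv ^^ j) (poly (laguerre \<alpha> s)) (y / real s))"
          using s(1) by (intro sum.cong) (simp_all add: higher_deriv_laguerre[OF s] pw)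
        also have "\<dots> = exceptional_laguerre \<alpha> lam mu n (y / real s)"
          by (simp add: exceptional_laguerre_expansion A_def fs_def r_def n[unfolded S_def])
        finally show ?thesis by simp
      qed
      moreover have "?C * real s ^ r \<noteq> 0"
        using Gamma_real_pos[OF s(2)] s(1) by simp
      ultimately have eq: "exceptional_laguerre \<alpha> lam mu n (y / real s) = 0 \<longleftrightarrow> f s y = 0" for y
        by (metis mult_eq_0_iff)
      show "is_pos_zero (exceptional_laguerre \<alpha> lam mu n) k (x / real s)"
      proof (rule is_pos_zero_transfer[where \<phi> = "\<lambda>y. y / real s", OF _ _ eq x])
        show "strict_mono_on {0<..} (\<lambda>y. y / real s)"
          using s(1) by (intro strict_mono_onI) (simp add: divide_strict_right_mono)
        show "(\<lambda>y. y / real s) ` {0<..} = {0<..}"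
        proof (intro equalityI subsetI)
          fix y :: real assume "y \<in> {0<..}"
          then show "y \<in> (\<lambda>y. y / real s) ` {0<..}"
            using s(1) by (intro image_eqI[of _ _ "y * real s"]) auto
        qed (use s(1) in auto)
      qed
    qed
  qed
  define X where "X s = pos_zero (f s) k" for s
  \<comment> \<open>The \<open>k\<close>th zero is unique, so any witness near \<open>z\<close> is
    the chosen \<open>X s\<close>.\<close>
  have X: "is_pos_zero (f s) k (X s) \<and> dist (X s) z < e"
    if "\<exists>x. is_pos_zero (f s) k x \<and> dist x z < e" for s e
    using that pos_zero_eqI[of "f s" k] by (auto simp: X_def)
  have "X \<longlonglongrightarrow> z"
  proof (rule tendstoI)
    fix e :: real assume "e > 0"
    from near[OF this] show "eventually (\<lambda>s. dist (X s) z < e) sequentially"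
      by eventually_elim (use X in blast)
  qed
  have "eventually (\<lambda>s. \<forall>n. S n = s \<longrightarrow>
      is_pos_zero (exceptional_laguerre \<alpha> lam mu n) k (X s / real s)) sequentially"
  proof -
    have "eventually (\<lambda>s. \<exists>x. is_pos_zero (f s) k x \<and> dist x z < 1) sequentially"
      by (rule near) simp
    with zeros show ?thesis by eventually_elim (use X in blast)
  qed
  from eventually_compose_filterlim[OF this S_top]
  have exc: "eventually (\<lambda>n. is_pos_zero (exceptional_laguerre \<alpha> lam mu n) k (X (S n) / real (S n)))
      sequentially"
    by (rule eventually_mono) blast
  have ratio: "(\<lambda>n. real n / real (S n)) \<longlonglongrightarrow> 1"
  proof -
    have "(\<lambda>n. inverse (1 + c / real n)) \<longlonglongrightarrow> inverse (1 + 0)"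
      by (intro tendsto_intros lim_const_over_n) simp
    moreover have "eventually (\<lambda>n. inverse (1 + c / real n) = real n / real (S n)) sequentially"
      using real_S eventually_gt_at_top[of 0]
      by eventually_elim (simp add: field_simps)
    ultimately show ?thesis
      by (simp add: tendsto_cong)
  qed
  \<comment> \<open>The zero in the original variable is \<open>X (S n) / S n\<close>; grouping the
    denominator with \<open>n\<close> leaves two convergent factors.\<close>
  have "(\<lambda>n. sqrt (4 * (real n / real (S n)) * X (S n))) \<longlonglongrightarrow> sqrt (4 * 1 * z)"
    by (intro tendsto_intros ratio filterlim_compose[OF \<open>X \<longlonglongrightarrow> z\<close> S_top])
  moreover have "eventually (\<lambda>n. sqrt (4 * (real n / real (S n)) * X (S n)) =
      sqrt (4 * real n * pos_zero (exceptional_laguerre \<alpha> lam mu n) k)) sequentially"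
    using exc by eventually_elim (simp add: pos_zero_eqI)
  ultimately have "(\<lambda>n. sqrt (4 * real n * pos_zero (exceptional_laguerre \<alpha> lam mu n) k))
      \<longlonglongrightarrow> sqrt (4 * 1 * z)"
    by (rule Lim_transform_eventually)
  moreover have "sqrt (4 * 1 * z) = pos_zero (bessel_J \<nu>) k"
    using pos_zero_eqI[OF is_pos_zero_bessel_J[OF z]] by (simp add: real_sqrt_mult)
  ultimately have "(\<lambda>n. sqrt (4 * real n * pos_zero (exceptional_laguerre \<alpha> lam mu n) k))
      \<longlonglongrightarrow> pos_zero (bessel_J \<nu>) k"
    by simp
  then show ?thesis
    \<comment> \<open>Both claims hold along all \<open>n\<close>, so restricting to the degree
      sequence only passes to a finer filter.\<close>
    using exc unfolding \<nu>_def r_def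
    by (intro conjI tendsto_mono[OF inf_le1] filter_leD[OF inf_le1])
       (auto elim: eventually_mono)
qed

end
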